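(* Let $P = S_1 \times \dots \times S_N$ be a finite product of finite total orders, $\mathbb{F}$ a field, and $F \colon P \to \mathsf{Vec}_{\mathbb{F}}$ a pointwise finite-dimensional functor that is $k$-middle-exact for all $2 \le k \le N$. Then $F$ is interval decomposable.
   Context: $\mathsf{Vec}_{\mathbb{F}}$ is the category of $\mathbb{F}$-vector spaces. Products of posets carry the product partial order; posets are regarded as categories. Pointwise finite-dimensional means $F(x)$ is finite-dimensional for all $x\in P$. Cubes: let $[k-1]=\{0,\dots,k-1\}$ and let $\mathcal{P}([k-1])$ be its power set ordered by inclusion. A $k$-cube in a category is a functor $\mathcal{X}$ out of $\mathcal{P}([k-1])$; it is cocartesian if the canonical map $\operatorname{colim}_{S\subsetneq[k-1]}\mathcal{X}(S)\to\mathcal{X}([k-1])$ is an isomorphism, cartesian if the canonical map $\mathcal{X}(\emptyset)\to\lim_{\emptyset\ne S\subseteq[k-1]}\mathcal{X}(S)$ is an isomorphism, and strongly bicartesian if every face of dimension at least $2$ is both cartesian and cocartesian. Koszul complex: for a $k$-cube $\mathcal{X}$ in $\mathsf{Vec}_{\mathbb{F}}$, $K_{\mathcal{X}}$ is the chain complex with $(K_{\mathcal{X}})_i=\bigoplus_{S\subseteq[k-1],\,|S|=k-i}\mathcal{X}(S)$ and differential $\partial_{i+1}\colon (K_{\mathcal{X}})_{i+1}\to (K_{\mathcal{X}})_i$ given on the summand $\mathcal{X}(S)$ by $\sum_{j=0}^{i}(-1)^j\mathcal{X}(S\subseteq S\cup\{t_j\})$, where $t_0<\dots<t_i$ are the elements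 of $[k-1]\setminus S$. A functor $F\colon P\to\mathsf{Vec}_{\mathbb{F}}$ on a distributive lattice is $k$-middle-exact if for every strongly bicartesian $k$-cube $\mathcal{X}$ in $P$, the Koszul complex of $F\circ\mathcal{X}$ has trivial homology in all degrees $0<i<k$. An interval in $P$ is a subset $I\subset P$ such that (a) $x,y\in I$ and $x\le z\le y$ imply $z\in I$, and (b) any $x,y\in I$ are connected by a zigzag $x=a_0\le b_0\ge a_1\le\dots\le b_n=y$ of relations in $I$. The interval module $\mathbb{F}_I$ has $\mathbb{F}_I(x)=\mathbb{F}$ if $x\in I$ and $0$ otherwise, with $\mathbb{F}_I(x\le y)=\mathrm{id}_{\mathbb{F}}$ if $x,y\in I$ and $0$ otherwise. $F$ is interval decomposable if it is isomorphic to a direct sum of interval modules. *)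

theory Defs
  imports "Jordan_Normal_Form.VS_Connect"
begin

section \<open>Finite products of chains\<close>

text \<open>A poset is a carrier set \<open>P\<close> with a relation \<open>r\<close> such that \<open>partial_order_on P r\<close>.\<close>

definition prod_carrier :: "nat \<Rightarrow> (nat \<Rightarrow> 'a set) \<Rightarrow> (nat \<Rightarrow> 'a) set" where
  "prod_carrier N S = (\<Pi>\<^sub>E i\<in>{..<N}. S i)"

definition prod_order :: "nat \<Rightarrow> (nat \<Rightarrow> 'a set) \<Rightarrow> (nat \<Rightarrow> 'a rel) \<Rightarrow> (nat \<Rightarrow> 'a) rel" where
  "prod_order N S R =
     {(x, y). x \<in> prod_carrier N S \<and> y \<in> prod_carrier N S \<and> (\<forall>i<N. (x i, y i) \<in> R i)}"

section \<open>Strongly bicartesian cubes in a poset\<close>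

definition is_lub_in :: "'p set \<Rightarrow> 'p rel \<Rightarrow> 'p set \<Rightarrow> 'p \<Rightarrow> bool" where
  "is_lub_in P r D u \<longleftrightarrow>
     u \<in> P \<and> (\<forall>d\<in>D. (d, u) \<in> r) \<and> (\<forall>w\<in>P. (\<forall>d\<in>D. (d, w) \<in> r) \<longrightarrow> (u, w) \<in> r)"

definition is_glb_in :: "'p set \<Rightarrow> 'p rel \<Rightarrow> 'p set \<Rightarrow> 'p \<Rightarrow> bool" where
  "is_glb_in P r D l \<longleftrightarrow>
     l \<in> P \<and> (\<forall>d\<in>D. (l, d) \<in> r) \<and> (\<forall>w\<in>P. (\<forall>d\<in>D. (w, d) \<in> r) \<longrightarrow> (w, l) \<in> r)"

text \<open>A \<open>k\<close>-cube is a functor, i.e. a monotone map, on the subsets of \<open>{0, \<dots>, k-1}\<close>.\<close>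

definition cube :: "'p set \<Rightarrow> 'p rel \<Rightarrow> nat \<Rightarrow> (nat set \<Rightarrow> 'p) \<Rightarrow> bool" where
  "cube P r k X \<longleftrightarrow>
     (\<forall>S. S \<subseteq> {..<k} \<longrightarrow> X S \<in> P) \<and>
     (\<forall>S T. S \<subseteq> T \<and> T \<subseteq> {..<k} \<longrightarrow> (X S, X T) \<in> r)"

text \<open>The faces of a cube are its restrictions to the intervals \<open>{S. A \<subseteq> S \<and> S \<subseteq> B}\<close>; the
  dimension of such a face is \<open>card (B - A)\<close>. In a poset, colimits are least upper bounds and
  limits are greatest lower bounds, so the canonical comparison map is an isomorphism iff the
  terminal (initial) vertex of the face is the least upper (greatest lower) bound of the others.\<close>

definition cocartesian_face ::
  "'p set \<Rightarrow> 'p rel \<Rightarrow> (nat set \<Rightarrow> 'p) \<Rightarrow> nat set \<Rightarrow> nat set \<Rightarrow> bool" where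
  "cocartesian_face P r X A B \<longleftrightarrow> is_lub_in P r (X ` {S. A \<subseteq> S \<and> S \<subset> B}) (X B)"

definition cartesian_face ::
  "'p set \<Rightarrow> 'p rel \<Rightarrow> (nat set \<Rightarrow> 'p) \<Rightarrow> nat set \<Rightarrow> nat set \<Rightarrow> bool" where
  "cartesian_face P r X A B \<longleftrightarrow> is_glb_in P r (X ` {S. A \<subset> S \<and> S \<subseteq> B}) (X A)"

definition strongly_bicartesian :: "'p set \<Rightarrow> 'p rel \<Rightarrow> nat \<Rightarrow> (nat set \<Rightarrow> 'p) \<Rightarrow> bool" where
  "strongly_bicartesian P r k X \<longleftrightarrow>
     cube P r k X \<and>
     (\<forall>A B. A \<subseteq> B \<and> B \<subseteq> {..<k} \<and> card (B - A) \<ge> 2 \<longrightarrow>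
        cartesian_face P r X A B \<and> cocartesian_face P r X A B)"

section \<open>Functors from a poset to vector spaces\<close>

text \<open>The ground field is the type \<open>'f\<close>, viewed as a ring record through \<open>class_ring\<close>. Only the
  values of \<open>Ob\<close> on the poset, and of \<open>Mor x y\<close> on the carrier of \<open>Ob x\<close> for \<open>x \<le> y\<close>,
  are meaningful.\<close>

record ('p, 'f, 'v) vfunctor =
  Ob :: "'p \<Rightarrow> ('f, 'v) module"
  Mor :: "'p \<Rightarrow> 'p \<Rightarrow> 'v \<Rightarrow> 'v"

definition is_vfunctor :: "'p set \<Rightarrow> 'p rel \<Rightarrow> ('p, 'f::field, 'v) vfunctor \<Rightarrow> bool" where
  "is_vfunctor P r F \<longleftrightarrow>
     (\<forall>x\<in>P. vectorspace (class_ring :: 'f ring) (Ob F x)) \<and>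
     (\<forall>x y. (x, y) \<in> r \<longrightarrow> linear_map (class_ring :: 'f ring) (Ob F x) (Ob F y) (Mor F x y)) \<and>
     (\<forall>x\<in>P. \<forall>v\<in>carrier (Ob F x). Mor F x x v = v) \<and>
     (\<forall>x y z. (x, y) \<in> r \<and> (y, z) \<in> r \<longrightarrow>
        (\<forall>v\<in>carrier (Ob F x). Mor F x z v = Mor F y z (Mor F x y v)))"

definition pointwise_fin_dim :: "'p set \<Rightarrow> ('p, 'f::field, 'v) vfunctor \<Rightarrow> bool" where
  "pointwise_fin_dim P F \<longleftrightarrow> (\<forall>x\<in>P. vectorspace.fin_dim (class_ring :: 'f ring) (Ob F x))"

definition vfunctor_iso ::
  "'p set \<Rightarrow> 'p rel \<Rightarrow> ('p, 'f::field, 'v) vfunctor \<Rightarrow> ('p, 'f, 'w) vfunctor \<Rightarrow> bool" where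
  "vfunctor_iso P r F G \<longleftrightarrow>
     (\<exists>\<eta>. (\<forall>x\<in>P. linear_map (class_ring :: 'f ring) (Ob F x) (Ob G x) (\<eta> x) \<and>
                  bij_betw (\<eta> x) (carrier (Ob F x)) (carrier (Ob G x))) \<and>
          (\<forall>x y. (x, y) \<in> r \<longrightarrow>
             (\<forall>v\<in>carrier (Ob F x). \<eta> y (Mor F x y v) = Mor G x y (\<eta> x v))))"

text \<open>The fields \<open>mult\<close> and \<open>one\<close> of a module record play no role for vector spaces.\<close>

definition module_sum :: "'j set \<Rightarrow> ('j \<Rightarrow> ('f, 'v) module) \<Rightarrow> ('f, 'j \<Rightarrow> 'v) module" where
  "module_sum J M =
     \<lparr>carrier = {c \<in> (\<Pi>\<^sub>E j\<in>J. carrier (M j)). finite {j \<in> J. c j \<noteq> \<zero>\<^bsub>M j\<^esub>}},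
      mult = undefined, one = undefined,
      zero = (\<lambda>j\<in>J. \<zero>\<^bsub>M j\<^esub>),
      add = (\<lambda>c d. \<lambda>j\<in>J. c j \<oplus>\<^bsub>M j\<^esub> d j),
      smult = (\<lambda>a c. \<lambda>j\<in>J. a \<odot>\<^bsub>M j\<^esub> c j)\<rparr>"

definition vfunctor_sum ::
  "'j set \<Rightarrow> ('j \<Rightarrow> ('p, 'f, 'v) vfunctor) \<Rightarrow> ('p, 'f, 'j \<Rightarrow> 'v) vfunctor" where
  "vfunctor_sum J G =
     \<lparr>Ob = (\<lambda>x. module_sum J (\<lambda>j. Ob (G j) x)),
      Mor = (\<lambda>x y c. \<lambda>j\<in>J. Mor (G j) x y (c j))\<rparr>"

section \<open>Koszul complexes and middle-exactness\<close>

text \<open>\<open>koszul_index k i\<close> indexes the summands in degree \<open>i\<close>; it is only used for \<open>i \<le> k\<close>.\<close>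

definition koszul_index :: "nat \<Rightarrow> nat \<Rightarrow> nat set set" where
  "koszul_index k i = {S. S \<subseteq> {..<k} \<and> card S = k - i}"

definition koszul_space ::
  "('p, 'f, 'v) vfunctor \<Rightarrow> nat \<Rightarrow> (nat set \<Rightarrow> 'p) \<Rightarrow> nat \<Rightarrow> ('f, nat set \<Rightarrow> 'v) module" where
  "koszul_space F k X i = module_sum (koszul_index k i) (\<lambda>S. Ob F (X S))"

text \<open>\<open>koszul_diff F k X i\<close> is the differential from degree \<open>i\<close> to degree \<open>i - 1\<close>, for
  \<open>1 \<le> i \<le> k\<close>. For \<open>S\<close> in \<open>koszul_index k i\<close>, the elements \<open>t\<^sub>0 < \<dots> < t\<^sub>i\<^sub>-\<^sub>1\<close> of the complement
  are listed by \<open>sorted_list_of_set\<close>. The component of the image at \<open>T\<close> collects the contributions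
  of all summands \<open>S\<close> and positions \<open>j\<close> with \<open>S \<union> {t\<^sub>j} = T\<close>.\<close>

definition koszul_diff ::
  "('p, 'f::field, 'v) vfunctor \<Rightarrow> nat \<Rightarrow> (nat set \<Rightarrow> 'p) \<Rightarrow> nat \<Rightarrow> (nat set \<Rightarrow> 'v) \<Rightarrow> (nat set \<Rightarrow> 'v)"
  where
  "koszul_diff F k X i c =
     (\<lambda>T\<in>koszul_index k (i - 1).
        finsum (Ob F (X T))
          (\<lambda>(S, j). ((- 1) ^ j) \<odot>\<^bsub>Ob F (X T)\<^esub> Mor F (X S) (X T) (c S))
          {(S, j). S \<in> koszul_index k i \<and> j < i \<and>
                   T = S \<union> {sorted_list_of_set ({..<k} - S) ! j}})"

definition koszul_homology_trivial ::
  "('p, 'f::field, 'v) vfunctor \<Rightarrow> nat \<Rightarrow> (nat set \<Rightarrow> 'p) \<Rightarrow> nat \<Rightarrow> bool" where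
  "koszul_homology_trivial F k X i \<longleftrightarrow>
     {c \<in> carrier (koszul_space F k X i). koszul_diff F k X i c = \<zero>\<^bsub>koszul_space F k X (i - 1)\<^esub>}
     = koszul_diff F k X (i + 1) ` carrier (koszul_space F k X (i + 1))"

definition middle_exact :: "'p set \<Rightarrow> 'p rel \<Rightarrow> nat \<Rightarrow> ('p, 'f::field, 'v) vfunctor \<Rightarrow> bool" where
  "middle_exact P r k F \<longleftrightarrow>
     (\<forall>X. strongly_bicartesian P r k X \<longrightarrow>
        (\<forall>i. 0 < i \<and> i < k \<longrightarrow> koszul_homology_trivial F k X i))"

section \<open>Interval decomposability\<close>

definition poset_interval :: "'p set \<Rightarrow> 'p rel \<Rightarrow> 'p set \<Rightarrow> bool" where
  "poset_interval P r I \<longleftrightarrow>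
     I \<subseteq> P \<and>
     (\<forall>x\<in>I. \<forall>y\<in>I. \<forall>z\<in>P. (x, z) \<in> r \<and> (z, y) \<in> r \<longrightarrow> z \<in> I) \<and>
     (\<forall>x\<in>I. \<forall>y\<in>I. \<exists>(n::nat) a b.
        a 0 = x \<and> b n = y \<and>
        (\<forall>m\<le>n. a m \<in> I \<and> b m \<in> I \<and> (a m, b m) \<in> r) \<and>
        (\<forall>m<n. (a (Suc m), b m) \<in> r))"

definition interval_module :: "'p set \<Rightarrow> ('p, 'f::field, 'f) vfunctor" where
  "interval_module I =
     \<lparr>Ob = (\<lambda>x. \<lparr>carrier = (if x \<in> I then UNIV else {0}),
                 mult = (*), one = 1, zero = 0, add = (+), smult = (*)\<rparr>),
      Mor = (\<lambda>x y a. if x \<in> I \<and> y \<in> I then a else 0)\<rparr>"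

text \<open>HOL does not allow quantifying over the type of the index set, so the summands are indexed by
  a set of natural numbers, finite or infinite. This loses nothing for pointwise finite-dimensional
  functors on a finite poset, for which only finitely many summands can be nonzero.\<close>

definition interval_decomposable ::
  "'p set \<Rightarrow> 'p rel \<Rightarrow> ('p, 'f::field, 'v) vfunctor \<Rightarrow> bool" where
  "interval_decomposable P r F \<longleftrightarrow>
     (\<exists>(J :: nat set) I. (\<forall>j\<in>J. poset_interval P r (I j)) \<and>
        vfunctor_iso P r F (vfunctor_sum J (\<lambda>j. interval_module (I j))))"

end

theory Submission
  imports Defs "HOL-Library.Function_Algebras"
begin

text \<open>After coordinatizing, \<open>P\<close> is \<open>{x. x \<le> h}\<close> for some \<open>h :: nat \<Rightarrow> nat\<close>. Since every
  \<open>F(x)\<close> has finite dimension, it suffices to split a single interval module off a nonzero \<open>F\<close>,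
  because the complement is middle-exact again. The summand of a box \<open>[a, b]\<close> splits off as soon as
  some \<open>v \<in> F(a)\<close> dies at every point above \<open>a\<close> outside of the box, while its image in \<open>F(b)\<close> does
  not come from the points below \<open>b\<close> outside of the box.

  If \<open>v \<in> F(b)\<close> is nonzero, \<open>b\<close> has at least two non-maximal coordinates and \<open>v\<close> dies at every upper
  neighbour of \<open>b\<close>, then exactness next to the initial vertex of cubes lifts \<open>v\<close>, one coordinate at
  a time, to \<open>F(0)\<close>, which gives the box \<open>[0, b]\<close>. Dually, if \<open>a\<close> has at least two nonzero
  coordinates and \<open>F(a)\<close> is not spanned by the images of its lower neighbours, exactness next to the
  terminal vertex gives \<open>[a, h]\<close>. Otherwise \<open>F\<close> is generated by its values on the axes through
  \<open>0\<close> and detected by those on the axes through \<open>h\<close>, and squares suffice to find a box that is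
  bounded in one direction only.\<close>

section \<open>Diagrams of vector spaces on a box of integer points\<close>

text \<open>The bound of two coordinates comes from the cubes: a class is moved by a cube whose
  directions are the coordinate being moved together with those in which the class is known to die
  (or in which lower neighbours are taken), and middle-exactness says nothing about cubes of
  dimension one. A class that can leave in one coordinate only need not lift to \<open>0\<close> at
  all; these classes are the origin of the boxes bounded in a single direction.

  Two requirements shape the setting. The induction passes to complements, so what is assumed has to
  survive in a natural direct summand. Statements about preimages and spans do, because a natural
  projection can be applied to their witnesses. Moreover, all spaces of a diagram have to live in
  one type, so every F(x) is replaced by the coordinate functions of a chosen basis, inside one
  space of functions.\<close>

text \<open>The cubes used below: \<open>g\<close> groups the coordinates, and direction \<open>s\<close> of the cube moves all
  coordinates with label \<open>s\<close> from \<open>p\<close> to \<open>q\<close> at once.\<close>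

definition mix :: "(nat \<Rightarrow> nat) \<Rightarrow> (nat \<Rightarrow> 'a) \<Rightarrow> (nat \<Rightarrow> 'a) \<Rightarrow> nat set \<Rightarrow> nat \<Rightarrow> 'a" where
  "mix g p q S = (\<lambda>i. if g i \<in> S then q i else p i)"

lemma mix_mono:
  fixes p q :: "nat \<Rightarrow> 'a::order"
  shows "p \<le> q \<Longrightarrow> S \<subseteq> S' \<Longrightarrow> mix g p q S \<le> mix g p q S'"
  by (auto simp: mix_def le_fun_def)

lemma subset_singleton_of_card:
  assumes "finite A" "card A \<le> 1"
  shows "\<exists>k. A \<subseteq> {k}"
proof (cases "A = {}")
  case False
  then have "card A = 1" using assms by (simp add: Suc_leI card_gt_0_iff le_antisym)
  then show ?thesis by (auto simp: card_1_singleton_iff)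
qed simp

text \<open>The assumptions \<open>lift\<close> and \<open>descend\<close> are all that is used of middle-exactness: they come
  from exactness of the Koszul complex of a \<open>k\<close>-cube in degrees \<open>k - 1\<close> and \<open>1\<close>, respectively,
  where the signs of the differential do not matter.\<close>

locale diagram = vector_space scale
  for scale :: "'f::field \<Rightarrow> 'b::ab_group_add \<Rightarrow> 'b" (infixr "*s" 75) +
  fixes h :: "nat \<Rightarrow> nat" and N :: nat
    and T :: "(nat \<Rightarrow> nat) \<Rightarrow> (nat \<Rightarrow> nat) \<Rightarrow> 'b \<Rightarrow> 'b"
    and W :: "(nat \<Rightarrow> nat) \<Rightarrow> 'b set"
  assumes fin_dir: "finite {i. 0 < h i}"
    and card_dir: "card {i. 0 < h i} \<le> N"
    and T_linear: "x \<le> y \<Longrightarrow> y \<le> h \<Longrightarrow> Vector_Spaces.linear scale scale (T x y)"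
    and W_subspace: "x \<le> h \<Longrightarrow> subspace (W x)"
    and T_W: "x \<le> y \<Longrightarrow> y \<le> h \<Longrightarrow> v \<in> W x \<Longrightarrow> T x y v \<in> W y"
    and T_id: "x \<le> h \<Longrightarrow> v \<in> W x \<Longrightarrow> T x x v = v"
    and T_trans: "x \<le> y \<Longrightarrow> y \<le> z \<Longrightarrow> z \<le> h \<Longrightarrow> v \<in> W x \<Longrightarrow> T y z (T x y v) = T x z v"
    and lift: "\<lbrakk>p \<le> q; q \<le> h; finite L; 2 \<le> card L; card L \<le> N; l \<in> L; v \<in> W (mix g p q {l});
        \<And>j. j \<in> L - {l} \<Longrightarrow> T (mix g p q {l}) (mix g p q {l, j}) v = 0\<rbrakk>
      \<Longrightarrow> \<exists>w\<in>W p. T p (mix g p q {l}) w = v \<and> (\<forall>j\<in>L - {l}. T p (mix g p q {j}) w = 0)"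
    and descend: "\<lbrakk>p \<le> q; q \<le> h; finite L; 2 \<le> card L; card L \<le> N; l \<in> L;
        v \<in> W (mix g p q (L - {l}));
        T (mix g p q (L - {l})) (mix g p q L) v \<in>
          span (\<Union>j\<in>L - {l}. T (mix g p q (L - {j})) (mix g p q L) ` W (mix g p q (L - {j})))\<rbrakk>
      \<Longrightarrow> v \<in> span (\<Union>j\<in>L - {l}.
            T (mix g p q (L - {l, j})) (mix g p q (L - {l})) ` W (mix g p q (L - {l, j})))"
begin

sublocale endo: vector_space_pair scale scale ..

lemma T_0: "x \<le> y \<Longrightarrow> y \<le> h \<Longrightarrow> T x y 0 = 0"
  by (rule endo.linear_0[OF T_linear])

lemma T_diff: "x \<le> y \<Longrightarrow> y \<le> h \<Longrightarrow> T x y (v - w) = T x y v - T x y w"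
  by (rule endo.linear_diff[OF T_linear])

lemma T_scale: "x \<le> y \<Longrightarrow> y \<le> h \<Longrightarrow> T x y (c *s v) = c *s T x y v"
  by (rule endo.linear_scale[OF T_linear])

lemma T_span: "x \<le> y \<Longrightarrow> y \<le> h \<Longrightarrow> T x y ` span A = span (T x y ` A)"
  by (rule endo.linear_span_image[OF T_linear, symmetric])

lemma subspace_image: "x \<le> y \<Longrightarrow> y \<le> h \<Longrightarrow> subspace (T x y ` W x)"
  by (rule endo.linear_subspace_image[OF T_linear W_subspace]) (auto intro: order_trans)

section \<open>Moving a class one coordinate at a time\<close>

lemma lift_coord:
  assumes "finite L" "2 \<le> card L" "card L \<le> N" "p \<le> h" "\<And>j. j \<in> L \<Longrightarrow> p j \<le> c j \<and> c j \<le> h j" "l \<in> L"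
    and "v \<in> W (p(l := c l))"
    and "\<And>j. j \<in> L - {l} \<Longrightarrow> T (p(l := c l)) (p(l := c l, j := c j)) v = 0"
  shows "\<exists>w\<in>W p. T p (p(l := c l)) w = v \<and> (\<forall>j\<in>L - {l}. T p (p(j := c j)) w = 0)"
proof -
  \<comment> \<open>With \<open>g = id\<close> and this top vertex, the vertices of the cube are the
    updates of \<open>p\<close> at coordinates in \<open>L\<close>; all other coordinates agree in
    \<open>p\<close> and \<open>?q\<close> and never move.\<close>
  let ?q = "\<lambda>i. if i \<in> L then c i else p i"
  have 1: "mix id p ?q {j} = p(j := c j)" if "j \<in> L" for j
    using that by (auto simp: mix_def)
  have 2: "mix id p ?q {l, j} = p(l := c l, j := c j)" if "j \<in> L" for j
    using that assms(6) by (auto simp: mix_def)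
  have "p \<le> ?q" "?q \<le> h" using assms(4,5) by (auto simp: le_fun_def)
  from lift[OF this assms(1-3,6), of v id] show ?thesis
    using assms(6-8) by (auto simp: 1 2)
qed

text \<open>The cube hangs below \<open>q\<close>, so its vertices are described by complements: at
  \<open>L - {j}\<close> only coordinate \<open>j\<close> still sits at \<open>c j\<close>.\<close>

lemma descend_coord:
  assumes "finite L" "2 \<le> card L" "card L \<le> N" "q \<le> h" "\<And>j. j \<in> L \<Longrightarrow> c j \<le> q j" "l \<in> L"
    and "v \<in> W (q(l := c l))"
    and "T (q(l := c l)) q v \<in> span (\<Union>j\<in>L - {l}. T (q(j := c j)) q ` W (q(j := c j)))"
  shows "v \<in> span (\<Union>j\<in>L - {l}. T (q(l := c l, j := c j)) (q(l := c l)) ` W (q(l := c l, j := c j)))"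
proof -
  let ?p = "\<lambda>i. if i \<in> L then c i else q i"
  have 0: "mix id ?p q L = q" by (auto simp: mix_def)
  have 1: "mix id ?p q (L - {j}) = q(j := c j)" if "j \<in> L" for j
    using that by (auto simp: mix_def)
  have 2: "mix id ?p q (L - {l, j}) = q(l := c l, j := c j)" if "j \<in> L" for j
    using that assms(6) by (auto simp: mix_def)
  have pq: "?p \<le> q" using assms(5) by (auto simp: le_fun_def)
  have 3: "(\<Union>j\<in>L - {l}. T (mix id ?p q (L - {j})) q ` W (mix id ?p q (L - {j}))) =
    (\<Union>j\<in>L - {l}. T (q(j := c j)) q ` W (q(j := c j)))"
    by (rule SUP_cong) (auto simp: 1)
  have 4: "(\<Union>j\<in>L - {l}. T (mix id ?p q (L - {l, j})) (q(l := c l)) ` W (mix id ?p q (L - {l, j}))) =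
    (\<Union>j\<in>L - {l}. T (q(l := c l, j := c j)) (q(l := c l)) ` W (q(l := c l, j := c j)))"
    by (rule SUP_cong) (auto simp: 2)
  from descend[OF pq assms(4,1-3,6), of v id] show ?thesis
    using assms(7,8) unfolding 0 1[OF assms(6)] 3 4 by blast
qed

text \<open>Induction on the set \<open>A\<close> of coordinates already lowered to
  \<open>0\<close>, with the deaths of the lifted class carried along. Lowering \<open>m\<close>
  takes one cube with the directions \<open>m\<close> and \<open>J\<close>; since it contains all of
  \<open>J\<close>, its dimension is at least two.\<close>

lemma lift_death:
  assumes "b \<le> h" "J = {j. b j < h j}" "2 \<le> card J" "v \<in> W b"
    and kill: "\<And>j. j \<in> J \<Longrightarrow> T b (b(j := Suc (b j))) v = 0"
  shows "\<exists>w\<in>W (\<lambda>_. 0). T (\<lambda>_. 0) b w = v \<and> (\<forall>j\<in>J. T (\<lambda>_. 0) ((\<lambda>_. 0)(j := Suc (b j))) w = 0)"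
proof -
  define lo where "lo A = (\<lambda>i. if i \<in> A then 0 else b i)" for A
  have JD: "J \<subseteq> {i. 0 < h i}" using assms(2) by auto
  have lob: "lo A \<le> b" for A by (auto simp: lo_def le_fun_def)
  have loh: "lo A \<le> h" for A using lob assms(1) order_trans by blast
  have loup: "(lo A)(j := Suc (b j)) \<le> h" if "j \<in> J" for A j
    using loh[of A] that assms(2) by (auto simp: le_fun_def Suc_le_eq)
  have "\<exists>w\<in>W (lo A). T (lo A) b w = v \<and> (\<forall>j\<in>J. T (lo A) ((lo A)(j := Suc (b j))) w = 0)"
    if "finite A" "A \<subseteq> {i. 0 < h i}" for A
    using that
  proof (induction A)
    case empty
    have "lo {} = b" by (auto simp: lo_def)
    then show ?case using assms(1,4) kill T_id by (auto simp del: fun_upd_apply)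
  next
    case (insert m A)
    then obtain w where w: "w \<in> W (lo A)" "T (lo A) b w = v"
      and wk: "\<And>j. j \<in> J \<Longrightarrow> T (lo A) ((lo A)(j := Suc (b j))) w = 0" by blast
    let ?p = "lo (insert m A)"
    let ?L = "insert m J"
    \<comment> \<open>Direction \<open>m\<close> only returns to \<open>b m\<close>, where the class
      to be lifted lives, even if \<open>m\<close> lies in \<open>J\<close>; all other directions
      step just past \<open>b\<close>.\<close>
    let ?c = "\<lambda>j. if j = m then b m else Suc (b j)"
    have pA: "?p(m := b m) = lo A" using insert.hyps by (auto simp: lo_def)
    have LD: "?L \<subseteq> {i. 0 < h i}" using JD insert.prems by auto
    have finL: "finite ?L" by (rule finite_subset[OF LD fin_dir])
    have cardL: "card ?L \<le> N" using card_mono[OF fin_dir LD] card_dir by linarith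
    have "2 \<le> card ?L" using assms(3) card_mono[OF finL, of J] by (meson le_trans subset_insertI)
    moreover have "?p j \<le> ?c j \<and> ?c j \<le> h j" if "j \<in> ?L" for j
      using that assms(1,2) by (auto simp: lo_def le_fun_def)
    moreover have "w \<in> W (?p(m := ?c m))" using w pA by simp
    moreover have "T (?p(m := ?c m)) (?p(m := ?c m, j := ?c j)) w = 0" if "j \<in> ?L - {m}" for j
      using wk[of j] that pA by (simp del: fun_upd_apply)
    ultimately obtain w' where w': "w' \<in> W ?p" "T ?p (?p(m := ?c m)) w' = w"
      and wk': "\<And>j. j \<in> ?L - {m} \<Longrightarrow> T ?p (?p(j := ?c j)) w' = 0"
      using lift_coord[of ?L ?p ?c m w] finL cardL loh by blast
    have pA': "?p \<le> lo A" by (auto simp: lo_def le_fun_def)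
    have "T ?p b w' = v"
      using T_trans[OF pA' lob assms(1) w'(1)] w' w(2) pA by simp
    moreover have "T ?p (?p(j := Suc (b j))) w' = 0" if "j \<in> J" for j
    proof (cases "j = m")
      case False
      then show ?thesis using wk'[of j] that by (simp del: fun_upd_apply)
    next
      \<comment> \<open>The cube stops at \<open>b m\<close> in direction \<open>m\<close>, but the
        step to \<open>Suc (b m)\<close> factors through \<open>lo A\<close>, and \<open>w\<close>
        dies on the second leg.\<close>
      case True
      have eq: "?p(j := Suc (b j)) = (lo A)(j := Suc (b j))" using True by (auto simp: lo_def)
      have "lo A \<le> (lo A)(j := Suc (b j))" by (auto simp: lo_def le_fun_def)
      from T_trans[OF pA' this loup[OF that] w'(1)] show ?thesis
        using wk[OF that] w'(2) pA eq by simp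
    qed
    ultimately show ?case using w'(1) by blast
  qed
  from this[OF fin_dir] have *: "\<exists>w\<in>W (lo {i. 0 < h i}). T (lo {i. 0 < h i}) b w = v
      \<and> (\<forall>j\<in>J. T (lo {i. 0 < h i}) ((lo {i. 0 < h i})(j := Suc (b j))) w = 0)" by auto
  have "lo {i. 0 < h i} = (\<lambda>_. 0)" using assms(1) by (auto simp: lo_def le_fun_def fun_eq_iff) (metis le_zero_eq)
  with * show ?thesis by simp
qed

text \<open>The point moves from \<open>h\<close> down to \<open>a\<close>, one coordinate at a
  time. Unlike in \<open>lift_death\<close>, the coordinate being lowered may itself contribute to
  the span, and its share has to be removed before the cube applies.\<close>

lemma descend_birth:
  assumes "a \<le> h" "J = {j. 0 < a j}" "2 \<le> card J" "v \<in> W a"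
    and im: "T a h v \<in> span (\<Union>j\<in>J. T (h(j := a j - 1)) h ` W (h(j := a j - 1)))"
  shows "v \<in> span (\<Union>j\<in>J. T (a(j := a j - 1)) a ` W (a(j := a j - 1)))"
proof -
  define hi where "hi A = (\<lambda>i. if i \<in> A then a i else h i)" for A
  have JD: "J \<subseteq> {i. 0 < h i}" using assms(1,2) by (auto simp: le_fun_def intro: less_le_trans)
  have hia: "a \<le> hi A" for A using assms(1) by (auto simp: hi_def le_fun_def)
  have hih: "hi A \<le> h" for A using assms(1) by (auto simp: hi_def le_fun_def)
  define U where "U A j = T ((hi A)(j := a j - 1)) (hi A) ` W ((hi A)(j := a j - 1))" for A j
  have hiA: "(hi A)(j := a j - 1) \<le> hi A" for A j
    using hia[of A] by (auto simp: le_fun_def) (metis diff_le_self le_trans)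
  have Usub: "subspace (U A j)" for A j
    unfolding U_def by (rule subspace_image[OF hiA hih])
  have "T a (hi A) v \<in> span (\<Union>j\<in>J. U A j)" if "finite A" "A \<subseteq> {i. 0 < h i}" for A
    using that
  proof (induction A)
    case empty
    have "hi {} = h" by (auto simp: hi_def)
    then show ?case using im by (simp add: U_def)
  next
    case (insert m A)
    let ?q = "hi A"
    let ?L = "insert m J"
    let ?c = "\<lambda>j. if j = m then a m else a j - 1"
    have qm: "?q(m := a m) = hi (insert m A)" by (auto simp: hi_def)
    have LD: "?L \<subseteq> {i. 0 < h i}" using JD insert.prems by auto
    have finL: "finite ?L" by (rule finite_subset[OF LD fin_dir])
    have cardL: "card ?L \<le> N" using card_mono[OF fin_dir LD] card_dir by linarith
    have card2: "2 \<le> card ?L" using assms(3) card_mono[OF finL, of J] by (meson le_trans subset_insertI)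
    have IH: "T a ?q v \<in> span (\<Union>j\<in>J. U A j)" using insert.IH insert.prems by blast
    have mm: "hi (insert m A) \<le> hi A" using assms(1) by (auto simp: hi_def le_fun_def)
    have "(\<Union>j\<in>J. U A j) \<subseteq> (if m \<in> J then U A m else {0}) \<union> (\<Union>j\<in>J-{m}. U A j)" by auto
    with IH have "T a ?q v \<in> span ((if m \<in> J then U A m else {0}) \<union> (\<Union>j\<in>J-{m}. U A j))"
      using span_mono by blast
    then obtain z y where z: "z \<in> span (if m \<in> J then U A m else {0})"
      and y: "y \<in> span (\<Union>j\<in>J-{m}. U A j)" "T a ?q v = z + y"
      unfolding span_Un by blast
    \<comment> \<open>If present, the share \<open>z\<close> of direction \<open>m\<close> comes
      from a point whose coordinate \<open>m\<close> is \<open>a m - 1\<close>. That point already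
      lies below \<open>hi (insert m A)\<close>, so \<open>z\<close> has a preimage
      \<open>z'\<close> there of the required kind.\<close>
    have "\<exists>z'\<in>W (hi (insert m A)). T (hi (insert m A)) ?q z' = z \<and> z' \<in> span (\<Union>j\<in>J. U (insert m A) j)"
    proof (cases "m \<in> J")
      case False
      then have "z = 0" using z by auto
      then show ?thesis
        using T_0[OF mm hih] subspace_0[OF W_subspace[OF hih]] span_zero by blast
    next
      case True
      then have "z \<in> U A m" using z Usub[of A m] by (simp add: span_eq_iff[THEN iffD2])
      then obtain t where t: "t \<in> W ((hi A)(m := a m - 1))" "z = T ((hi A)(m := a m - 1)) (hi A) t"
        unfolding U_def by auto
      have eq: "(hi (insert m A))(m := a m - 1) = (hi A)(m := a m - 1)" by (auto simp: hi_def)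
      have le: "(hi A)(m := a m - 1) \<le> hi (insert m A)" using hiA[of "insert m A" m] eq by simp
      have "T ((hi A)(m := a m - 1)) (hi (insert m A)) t \<in> U (insert m A) m"
        unfolding U_def eq using t by auto
      then have "T ((hi A)(m := a m - 1)) (hi (insert m A)) t \<in> span (\<Union>j\<in>J. U (insert m A) j)"
        using True by (intro span_base) auto
      then show ?thesis
        using T_W[OF le hih t(1)] T_trans[OF le mm hih t(1)] t(2) by auto
    qed
    then obtain z' where z': "z' \<in> W (hi (insert m A))" "T (hi (insert m A)) ?q z' = z"
      "z' \<in> span (\<Union>j\<in>J. U (insert m A) j)" by auto
    \<comment> \<open>Without \<open>z'\<close>, the image at \<open>hi A\<close> lies in the span
      for the directions other than \<open>m\<close>, as the cube demands; \<open>z'\<close> is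
      added back at the end.\<close>
    let ?v = "T a (hi (insert m A)) v - z'"
    have vW: "?v \<in> W (?q(m := ?c m))"
      using subspace_diff[OF W_subspace[OF hih]] T_W[OF hia hih assms(4)] z'(1) qm by simp
    have "T (hi (insert m A)) ?q ?v = y"
      using T_diff[OF mm hih] T_trans[OF hia mm hih assms(4)] z'(2) y(2) by simp
    also have "(\<Union>j\<in>J-{m}. U A j) = (\<Union>j\<in>?L-{m}. T (?q(j := ?c j)) ?q ` W (?q(j := ?c j)))"
      by (auto simp: U_def)
    ultimately have img: "T (?q(m := ?c m)) ?q ?v \<in> span (\<Union>j\<in>?L-{m}. T (?q(j := ?c j)) ?q ` W (?q(j := ?c j)))"
      using y(1) qm by simp
    have cle: "?c j \<le> ?q j" if "j \<in> ?L" for j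
      using hia[of A] by (auto simp: le_fun_def) (metis diff_le_self le_trans)
    have "?v \<in> span (\<Union>j\<in>?L-{m}. T (?q(m := ?c m, j := ?c j)) (?q(m := ?c m)) ` W (?q(m := ?c m, j := ?c j)))"
      using descend_coord[OF finL card2 cardL hih, where c = ?c and l = m and v = ?v] cle vW img by blast
    also have "(\<Union>j\<in>?L-{m}. T (?q(m := ?c m, j := ?c j)) (?q(m := ?c m)) ` W (?q(m := ?c m, j := ?c j)))
      = (\<Union>j\<in>J-{m}. U (insert m A) j)"
      using qm by (auto simp: U_def)
    also have "span \<dots> \<subseteq> span (\<Union>j\<in>J. U (insert m A) j)" by (intro span_mono) auto
    finally have "?v + z' \<in> span (\<Union>j\<in>J. U (insert m A) j)" using z'(3) span_add by blast
    then show ?case by simp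
  qed
  from this[OF fin_dir] have *: "T a (hi {i. 0 < h i}) v \<in> span (\<Union>j\<in>J. U {i. 0 < h i} j)" by blast
  have "hi {i. 0 < h i} = a" using assms(1) by (auto simp: hi_def le_fun_def fun_eq_iff) (metis le_zero_eq)
  with * show ?thesis using T_id assms(1,4) by (simp add: U_def)
qed

section \<open>Axes through \<open>0\<close> and through \<open>h\<close>\<close>

definition ax :: "nat \<Rightarrow> nat \<Rightarrow> nat \<Rightarrow> nat" where "ax i s = (\<lambda>_. 0)(i := s)"

text \<open>\<open>ax i s\<close> is the least point with \<open>i\<close>-th coordinate at least
  \<open>s\<close>, and for \<open>t \<le> h i\<close>, \<open>coax i t\<close> is the greatest
  point below \<open>h\<close> with \<open>i\<close>-th coordinate at most \<open>t\<close>. Hence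
  the box between them is the band \<open>s \<le> x i \<le> t\<close>, with no condition on other
  coordinates.\<close>

definition coax :: "nat \<Rightarrow> nat \<Rightarrow> nat \<Rightarrow> nat" where "coax i t = h(i := t)"

lemma ax_le_iff: "ax i s \<le> x \<longleftrightarrow> s \<le> x i"
  by (auto simp: ax_def le_fun_def)

lemma le_coax_iff: "x \<le> h \<Longrightarrow> x \<le> coax i t \<longleftrightarrow> x i \<le> t"
  by (auto simp: coax_def le_fun_def)

lemma coax_le: "t \<le> h i \<Longrightarrow> coax i t \<le> h"
  by (auto simp: coax_def le_fun_def)

lemma coax_top: "coax i (h i) = h"
  by (simp add: coax_def)

lemma ax_0: "ax i 0 = (\<lambda>_. 0)"
  by (auto simp: ax_def)

lemma ax_apply: "ax i s j = (if j = i then s else 0)"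
  by (simp add: ax_def)

lemma coax_apply: "coax i t j = (if j = i then t else h j)"
  by (simp add: coax_def)

lemma bottom_le: "(\<lambda>_. 0) \<le> (x :: nat \<Rightarrow> nat)"
  by (simp add: le_fun_def)

text \<open>For \<open>N < 2\<close> nothing is assumed about squares, but then those of the next two lemmas are
  degenerate.\<close>

lemma few_directions:
  assumes "N < 2" "0 < h i" "j \<noteq> i"
  shows "h j = 0"
proof (rule ccontr)
  assume "h j \<noteq> 0"
  then have "{i, j} \<subseteq> {i. 0 < h i}" using assms by auto
  from card_mono[OF fin_dir this] card_dir assms show False by simp
qed

text \<open>The square has the vertices \<open>0\<close>, \<open>ax i (h i)\<close>,
  \<open>coax i 0\<close> and \<open>h\<close>: one direction moves coordinate \<open>i\<close>, the
  other moves all remaining coordinates together. The labels \<open>g\<close> of \<open>mix\<close>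
  make this a square whatever the number of coordinates.\<close>

lemma sq_lift:
  assumes v: "v \<in> W (ax i (h i))" and 0: "T (ax i (h i)) h v = 0"
  shows "\<exists>u\<in>W (\<lambda>_. 0). T (\<lambda>_. 0) (ax i (h i)) u = v \<and> T (\<lambda>_. 0) (coax i 0) u = 0"
proof (cases "2 \<le> N")
  case True
  let ?g = "\<lambda>j. if j = i then 0 else 1 :: nat"
  have 1: "mix ?g (\<lambda>_. 0) h {0} = ax i (h i)" "mix ?g (\<lambda>_. 0) h {0, 1} = h"
    "mix ?g (\<lambda>_. 0) h {1} = coax i 0"
    by (auto simp: mix_def ax_def coax_def)
  have L: "{0, 1} - {0} = {1 :: nat}" by auto
  show ?thesis
    using lift[OF bottom_le order_refl, of "{0, 1}" 0 v ?g] True v 0 unfolding 1 L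
    by (simp add: 1[simplified])
next
  case False
  show ?thesis
  proof (cases "0 < h i")
    case True
    then have "ax i (h i) = h" using few_directions[of i] False
      by (auto simp: ax_def fun_eq_iff)
    then have "v = 0" using v 0 T_id by simp
    then show ?thesis
      using subspace_0[OF W_subspace[OF bottom_le]] T_0[OF bottom_le]
      by (intro bexI[of _ 0]) (auto simp: ax_le_iff coax_le)
  next
    case False
    then have "ax i (h i) = (\<lambda>_. 0)" "coax i 0 = h" using ax_0 coax_top[of i] by auto
    then show ?thesis using v 0 T_id[OF bottom_le] by auto
  qed
qed

text \<open>The square has the vertices \<open>0\<close>, \<open>ax i t\<close>,
  \<open>coax i 0\<close> and \<open>coax i t\<close>. It serves to show that a class on an axis
  which also comes from the points with \<open>i\<close>-th coordinate \<open>0\<close> was born at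
  \<open>0\<close>.\<close>

lemma sq_descend:
  assumes t: "t \<le> h i" and v: "v \<in> W (ax i t)" and w: "w \<in> W (coax i 0)"
    and eq: "T (ax i t) (coax i t) v = T (coax i 0) (coax i t) w"
  shows "\<exists>u\<in>W (\<lambda>_. 0). T (\<lambda>_. 0) (coax i t) u = T (ax i t) (coax i t) v"
proof (cases "2 \<le> N")
  case True
  let ?g = "\<lambda>j. if j = i then 0 else 1 :: nat"
  have 1: "mix ?g (\<lambda>_. 0) (coax i t) {0} = ax i t" "mix ?g (\<lambda>_. 0) (coax i t) {0, 1} = coax i t"
    "mix ?g (\<lambda>_. 0) (coax i t) {1} = coax i 0" "mix ?g (\<lambda>_. 0) (coax i t) {} = (\<lambda>_. 0)"
    by (auto simp: mix_def ax_def coax_def)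
  have L: "{0, 1} - {1} = {0 :: nat}" "{0, 1} - {0} = {1 :: nat}" "{0, 1} - {1, 0} = ({} :: nat set)" by auto
  have le: "ax i t \<le> h" using t by (simp add: ax_le_iff)
  have "T (ax i t) (coax i t) v \<in> span (T (coax i 0) (coax i t) ` W (coax i 0))"
    using w unfolding eq by (intro span_base imageI)
  then have "v \<in> span (T (\<lambda>_. 0) (ax i t) ` W (\<lambda>_. 0))"
    using descend[OF bottom_le coax_le[OF t], of "{0, 1}" 1 v ?g] True v
    by (simp add: 1 L 1[simplified] L[simplified])
  then have "v \<in> T (\<lambda>_. 0) (ax i t) ` W (\<lambda>_. 0)"
    using span_eq_iff[THEN iffD2, OF subspace_image[OF bottom_le le]] by simp
  then obtain u where "u \<in> W (\<lambda>_. 0)" "v = T (\<lambda>_. 0) (ax i t) u" by blast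
  then show ?thesis using T_trans[OF bottom_le _ coax_le[OF t], of "ax i t" u] by (auto simp: ax_le_iff coax_apply)
next
  case False
  show ?thesis
  proof (cases "0 < h i")
    case True
    then have "coax i 0 = (\<lambda>_. 0)" using few_directions[of i] False
      by (auto simp: coax_def fun_eq_iff)
    then show ?thesis using eq w by auto
  next
    case False
    then have "ax i t = (\<lambda>_. 0)" using ax_0 t by auto
    then show ?thesis using v by auto
  qed
qed

text \<open>A point off the axes has at least two positive coordinates, so its space is generated
  from its lower neighbours. Repeating this, with the coordinate sum as measure, ends on the
  axes.\<close>

lemma generated_by_axes:
  assumes gen: "\<And>a. a \<le> h \<Longrightarrow> 2 \<le> card {j. 0 < a j} \<Longrightarrow>
      W a \<subseteq> span (\<Union>j\<in>{j. 0 < a j}. T (a(j := a j - 1)) a ` W (a(j := a j - 1)))"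
    and "x \<le> h"
  shows "W x \<subseteq> span (\<Union>(j, s)\<in>{(j, s). s \<le> x j}. T (ax j s) x ` W (ax j s))"
  using assms(2)
proof (induction x rule: measure_induct_rule[where f = "\<lambda>x. sum x {i. 0 < h i}"])
  case (less x)
  let ?G = "\<lambda>x. \<Union>(j, s)\<in>{(j, s). s \<le> x j}. T (ax j s) x ` W (ax j s)"
  have xD: "{j. 0 < x j} \<subseteq> {i. 0 < h i}"
    using less.prems by (auto simp: le_fun_def intro: less_le_trans)
  have finx: "finite {j. 0 < x j}" by (rule finite_subset[OF xD fin_dir])
  show ?case
  proof (cases "2 \<le> card {j. 0 < x j}")
    case True
    have "T (x(j := x j - 1)) x ` W (x(j := x j - 1)) \<subseteq> span (?G x)" if j: "0 < x j" for j
    proof -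
      let ?y = "x(j := x j - 1)"
      have yx: "?y \<le> x" by (auto simp: le_fun_def)
      then have yh: "?y \<le> h" using less.prems by (rule order_trans)
      have "sum ?y {i. 0 < h i} < sum x {i. 0 < h i}"
        using j xD fin_dir by (intro sum_strict_mono_ex1) auto
      then have "W ?y \<subseteq> span (?G ?y)" by (rule less.IH[OF _ yh])
      then have "T ?y x ` W ?y \<subseteq> span (T ?y x ` ?G ?y)"
        using T_span[OF yx less.prems, of "?G ?y"] by blast
      also have "T ?y x ` ?G ?y \<subseteq> ?G x"
      proof safe
        fix k s w assume s: "s \<le> ?y k" and w: "w \<in> W (ax k s)"
        have "T ?y x (T (ax k s) ?y w) = T (ax k s) x w"
          using s w yx less.prems by (intro T_trans) (auto simp: ax_le_iff)
        moreover have "s \<le> x k" using s yx by (auto simp: le_fun_def split: if_splits)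
        ultimately show "T ?y x (T (ax k s) ?y w) \<in> ?G x" using w by auto
      qed
      then have "span (T ?y x ` ?G ?y) \<subseteq> span (?G x)" by (rule span_mono)
      finally show ?thesis .
    qed
    then have "(\<Union>j\<in>{j. 0 < x j}. T (x(j := x j - 1)) x ` W (x(j := x j - 1))) \<subseteq> span (?G x)"
      by blast
    then have "span (\<Union>j\<in>{j. 0 < x j}. T (x(j := x j - 1)) x ` W (x(j := x j - 1))) \<subseteq> span (?G x)"
      by (rule span_minimal) (rule subspace_span)
    with gen[OF less.prems True] show ?thesis by (rule order_trans)
  next
    case False
    then have "card {j. 0 < x j} \<le> 1" by simp
    then obtain k where k: "{j. 0 < x j} \<subseteq> {k}"
      using subset_singleton_of_card[OF finx] by blast
    then have xk: "x = ax k (x k)" by (auto simp: ax_def fun_eq_iff)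
    show ?thesis
    proof
      fix v assume v: "v \<in> W x"
      have "T (ax k (x k)) x v = v" using T_id[OF less.prems v] xk by simp
      moreover have "v \<in> W (ax k (x k))" using v xk by simp
      ultimately have "v \<in> T (ax k (x k)) x ` W (ax k (x k))" by (metis imageI)
      then have "v \<in> ?G x" by (intro UN_I[of "(k, x k)"]) auto
      then show "v \<in> span (?G x)" by (rule span_base)
    qed
  qed
qed

text \<open>Dually, away from the axes through \<open>h\<close> a nonzero class survives in some
  upper neighbour, and following it upwards ends on one of these axes. The measure is the number of
  steps left up to \<open>h\<close>.\<close>

lemma cogenerated_by_coaxes:
  assumes cogen: "\<And>b v. b \<le> h \<Longrightarrow> 2 \<le> card {j. b j < h j} \<Longrightarrow> v \<in> W b \<Longrightarrow>
      (\<And>j. b j < h j \<Longrightarrow> T b (b(j := Suc (b j))) v = 0) \<Longrightarrow> v = 0"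
    and "x \<le> h" "v \<in> W x" "v \<noteq> 0"
  shows "\<exists>i t. x i \<le> t \<and> t \<le> h i \<and> T x (coax i t) v \<noteq> 0"
  using assms(2-)
proof (induction x arbitrary: v rule: measure_induct_rule[where f = "\<lambda>x. \<Sum>i | 0 < h i. h i - x i"])
  case (less x)
  have xD: "{j. x j < h j} \<subseteq> {i. 0 < h i}" by auto
  have finx: "finite {j. x j < h j}" by (rule finite_subset[OF xD fin_dir])
  show ?case
  proof (cases "2 \<le> card {j. x j < h j}")
    case True
    then obtain j where j: "x j < h j" "T x (x(j := Suc (x j))) v \<noteq> 0"
      using cogen[of x v] less.prems by blast
    let ?y = "x(j := Suc (x j))"
    have xy: "x \<le> ?y" by (auto simp: le_fun_def)
    have yh: "?y \<le> h" using less.prems(1) j by (auto simp: le_fun_def)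
    have "(\<Sum>i | 0 < h i. h i - ?y i) < (\<Sum>i | 0 < h i. h i - x i)"
      using j fin_dir by (intro sum_strict_mono_ex1) (auto intro!: exI[of _ j])
    from less.IH[OF this yh T_W[OF xy yh less.prems(2)] j(2)]
    obtain i t where it: "?y i \<le> t" "t \<le> h i" "T ?y (coax i t) (T x ?y v) \<noteq> 0" by blast
    have "T ?y (coax i t) (T x ?y v) = T x (coax i t) v"
      using it yh by (intro T_trans[OF xy _ _ less.prems(2)]) (simp_all add: le_coax_iff coax_le del: fun_upd_apply)
    moreover have "x i \<le> ?y i" by simp
    ultimately show ?thesis using it by (metis le_trans)
  next
    case False
    then have "card {j. x j < h j} \<le> 1" by simp
    then obtain k where k: "{j. x j < h j} \<subseteq> {k}"
      using subset_singleton_of_card[OF finx] by blast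
    have "x j = coax k (x k) j" for j
    proof (cases "j = k")
      case False
      then have "\<not> x j < h j" using k by blast
      then show ?thesis using False le_funD[OF less.prems(1), of j] by (simp add: coax_apply)
    qed (simp add: coax_apply)
    then have "x = coax k (x k)" ..
    then show ?thesis using T_id[OF less.prems(1,2)] less.prems(1,3)
      by (intro exI[of _ k] exI[of _ "x k"]) (auto simp: le_fun_def)
  qed
qed

end

section \<open>Existence of a box that splits off\<close>

context diagram begin

text \<open>The vanishing condition makes \<open>1 \<mapsto> v\<close> extend to a natural map from
  the interval module of the box. The span condition provides a functional at \<open>b\<close> that
  extends to a natural map in the other direction, and the two can be scaled to compose to the
  identity of the interval module.\<close>

definition splits_off :: "(nat \<Rightarrow> nat) \<Rightarrow> (nat \<Rightarrow> nat) \<Rightarrow> 'b \<Rightarrow> bool" where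
  "splits_off a b v \<longleftrightarrow> a \<le> b \<and> b \<le> h \<and> v \<in> W a \<and>
     (\<forall>x. a \<le> x \<longrightarrow> x \<le> h \<longrightarrow> \<not> x \<le> b \<longrightarrow> T a x v = 0) \<and>
     T a b v \<notin> span (\<Union>x\<in>{x. x \<le> b \<and> \<not> a \<le> x}. T x b ` W x)"

text \<open>With the lower corner at \<open>0\<close> the union in the span condition is empty, so
  \<open>v \<noteq> 0\<close> is enough there. A point not below \<open>b\<close> exceeds
  \<open>b\<close> in some coordinate \<open>j\<close> and hence lies above
  \<open>ax j (Suc (b j))\<close>, where the lifted class dies.\<close>

lemma death_splits_off:
  assumes "b \<le> h" "2 \<le> card {j. b j < h j}" "v \<in> W b" "v \<noteq> 0"
    and kill: "\<And>j. b j < h j \<Longrightarrow> T b (b(j := Suc (b j))) v = 0"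
  shows "\<exists>w. splits_off (\<lambda>_. 0) b w"
proof -
  obtain w where w: "w \<in> W (\<lambda>_. 0)" "T (\<lambda>_. 0) b w = v"
    and wk: "\<And>j. b j < h j \<Longrightarrow> T (\<lambda>_. 0) ((\<lambda>_. 0)(j := Suc (b j))) w = 0"
    using lift_death[OF assms(1) refl assms(2,3)] kill by blast
  have "T (\<lambda>_. 0) x w = 0" if x: "x \<le> h" "\<not> x \<le> b" for x
  proof -
    obtain j where j: "b j < x j" using x(2) by (auto simp: le_fun_def not_le)
    have jx: "ax j (Suc (b j)) \<le> x" using j by (simp add: ax_le_iff)
    have "b j < h j" using j x(1) by (auto simp: le_fun_def intro: less_le_trans)
    then have "T (\<lambda>_. 0) (ax j (Suc (b j))) w = 0" using wk by (simp add: ax_def)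
    then show ?thesis
      using T_trans[OF bottom_le jx x(1) w(1)] T_0[OF jx x(1)] by simp
  qed
  then show ?thesis
    using w assms(1,4) bottom_le by (intro exI[of _ w]) (auto simp: splits_off_def)
qed

text \<open>With the upper corner at \<open>h\<close> nothing has to vanish. A point not above
  \<open>a\<close> is smaller than \<open>a\<close> in some coordinate \<open>j\<close>, so its
  contribution at \<open>h\<close> factors through \<open>coax j (a j - 1)\<close>, and
  \<open>descend_birth\<close> carries membership in the span down to \<open>a\<close>.\<close>

lemma birth_splits_off:
  assumes "a \<le> h" "2 \<le> card {j. 0 < a j}" "v \<in> W a"
    and new: "v \<notin> span (\<Union>j\<in>{j. 0 < a j}. T (a(j := a j - 1)) a ` W (a(j := a j - 1)))"
  shows "splits_off a h v"
proof -
  let ?U = "\<Union>j\<in>{j. 0 < a j}. T (h(j := a j - 1)) h ` W (h(j := a j - 1))"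
  have "T a h v \<notin> span ?U"
  proof
    assume "T a h v \<in> span ?U"
    from descend_birth[OF assms(1) refl assms(2,3) this] new show False by contradiction
  qed
  moreover have "(\<Union>x\<in>{x. x \<le> h \<and> \<not> a \<le> x}. T x h ` W x) \<subseteq> ?U"
  proof safe
    fix x w assume x: "x \<le> h" "\<not> a \<le> x" and w: "w \<in> W x"
    then obtain j where j: "x j < a j" by (auto simp: le_fun_def not_le)
    have ah: "a j \<le> h j" using assms(1) by (simp add: le_fun_def)
    have xc: "x \<le> coax j (a j - 1)" using x(1) j by (simp add: le_coax_iff)
    have ch: "coax j (a j - 1) \<le> h" using ah by (intro coax_le) simp
    have "T x h w = T (coax j (a j - 1)) h (T x (coax j (a j - 1)) w)"
      using T_trans[OF xc ch order_refl w] by simp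
    moreover have "T x (coax j (a j - 1)) w \<in> W (coax j (a j - 1))" by (rule T_W[OF xc ch w])
    ultimately have "T x h w \<in> T (h(j := a j - 1)) h ` W (h(j := a j - 1))"
      unfolding coax_def by (metis imageI)
    then show "T x h w \<in> ?U" using j by (intro UN_I[of j]) auto
  qed
  ultimately show ?thesis
    using assms(1,3) span_mono unfolding splits_off_def by blast
qed

text \<open>The band is chosen extremal: \<open>conn i s t\<close> records that a class on the
  \<open>i\<close>-axis at \<open>s\<close> survives to \<open>coax i t\<close>, and
  \<open>s\<close> is minimal for \<open>i\<close>, then \<open>t\<close> maximal for
  \<open>s\<close>. Maximality of \<open>t\<close> lets the class be corrected so that it dies
  beyond \<open>t\<close>; minimality of \<open>s\<close> keeps it out of the span of what is
  older.\<close>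

lemma band_splits_off:
  assumes gen: "\<And>x. x \<le> h \<Longrightarrow> W x \<subseteq> span (\<Union>(j, s)\<in>{(j, s). s \<le> x j}. T (ax j s) x ` W (ax j s))"
    and cogen: "\<And>x v. x \<le> h \<Longrightarrow> v \<in> W x \<Longrightarrow> v \<noteq> 0 \<Longrightarrow>
      \<exists>i t. x i \<le> t \<and> t \<le> h i \<and> T x (coax i t) v \<noteq> 0"
    and x0: "x0 \<le> h" "w0 \<in> W x0" "w0 \<noteq> 0"
  shows "\<exists>a b v. splits_off a b v"
proof -
  define conn where
    "conn i s t \<longleftrightarrow> s \<le> t \<and> t \<le> h i \<and> (\<exists>w\<in>W (ax i s). T (ax i s) (coax i t) w \<noteq> 0)" for i s t
  have bot: "conn i 0 t" if "t \<le> h i" "u \<in> W (\<lambda>_. 0)" "T (\<lambda>_. 0) (coax i t) u \<noteq> 0" for i t u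
    using that by (auto simp: conn_def ax_0)
  \<comment> \<open>The class that survives to \<open>coax i t\<close> may come from another axis
    \<open>j\<close>. Either it reaches \<open>h\<close>, giving a band in direction
    \<open>j\<close>, or the square at \<open>ax j (h j)\<close> replaces it by a class at
    \<open>0\<close>, which also lies on the \<open>i\<close>-axis.\<close>
  have ex: "\<exists>i s t. conn i s t"
  proof -
    obtain i t where it: "x0 i \<le> t" "t \<le> h i" "T x0 (coax i t) w0 \<noteq> 0" using cogen[OF x0] by blast
    let ?c = "coax i t"
    have xc: "x0 \<le> ?c" using it x0 by (simp add: le_coax_iff)
    have ch: "?c \<le> h" by (rule coax_le[OF it(2)])
    have "\<exists>j s w. s \<le> x0 j \<and> w \<in> W (ax j s) \<and> T (ax j s) ?c w \<noteq> 0"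
    proof (rule ccontr)
      assume neg: "\<not> ?thesis"
      let ?G = "\<Union>(j, s)\<in>{(j, s). s \<le> x0 j}. T (ax j s) x0 ` W (ax j s)"
      have "T x0 ?c ` ?G \<subseteq> {0}"
      proof safe
        fix j s w assume s: "s \<le> x0 j" and w: "w \<in> W (ax j s)"
        have "T x0 ?c (T (ax j s) x0 w) = T (ax j s) ?c w"
          using s by (intro T_trans[OF _ xc ch w]) (simp add: ax_le_iff)
        then show "T x0 ?c (T (ax j s) x0 w) = 0" using neg s w by auto
      qed
      then have "span (T x0 ?c ` ?G) \<subseteq> span {0}" by (rule span_mono)
      then have "T x0 ?c ` span ?G \<subseteq> {0}" unfolding T_span[OF xc ch] by simp
      with gen[OF x0(1)] x0(2) it(3) show False by blast
    qed
    then obtain j s w where s: "s \<le> x0 j" and w: "w \<in> W (ax j s)" "T (ax j s) ?c w \<noteq> 0" by blast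
    have sh: "s \<le> h j" using s x0(1) by (auto simp: le_fun_def intro: order_trans)
    show ?thesis
    proof (cases "j = i")
      case True
      then have "conn i s t" using s w it by (auto simp: conn_def)
      then show ?thesis by blast
    next
      case False
      show ?thesis
      proof (cases "T (ax j s) h w = 0")
        case False
        then have "conn j s (h j)" using sh w(1) by (auto simp: conn_def coax_top)
        then show ?thesis by blast
      next
        case True
        have le1: "ax j s \<le> ax j (h j)" using sh by (simp add: ax_le_iff ax_apply)
        have le2: "ax j (h j) \<le> ?c" using False by (simp add: ax_le_iff coax_apply)
        have le3: "ax j (h j) \<le> h" by (simp add: ax_le_iff)
        have "T (ax j (h j)) h (T (ax j s) (ax j (h j)) w) = 0"
          using T_trans[OF le1 le3 order_refl w(1)] True by simp
        from sq_lift[OF T_W[OF le1 le3 w(1)] this] obtain u where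
          u: "u \<in> W (\<lambda>_. 0)" "T (\<lambda>_. 0) (ax j (h j)) u = T (ax j s) (ax j (h j)) w" by blast
        have "T (\<lambda>_. 0) ?c u = T (ax j s) ?c w"
          using T_trans[OF bottom_le le2 ch u(1)] T_trans[OF le1 le2 ch w(1)] u(2) by simp
        then show ?thesis using bot[OF it(2) u(1)] w(2) by auto
      qed
    qed
  qed
  then obtain i where i: "\<exists>s t. conn i s t" by blast
  define s where "s = (LEAST s. \<exists>t. conn i s t)"
  have s: "\<exists>t. conn i s t" unfolding s_def using i by (rule LeastI_ex)
  have smin: "\<not> conn i s' t'" if "s' < s" for s' t' using that not_less_Least unfolding s_def by blast
  define t where "t = (GREATEST t. conn i s t)"
  have bnd: "\<forall>y. conn i s y \<longrightarrow> y \<le> h i" by (simp add: conn_def)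
  have t: "conn i s t" unfolding t_def using s bnd by (auto intro: GreatestI_nat)
  have tmax: "\<not> conn i s t'" if "t < t'" for t'
    using that Greatest_le_nat[of "conn i s" t' "h i"] bnd unfolding t_def by force
  have st: "s \<le> t" "t \<le> h i" using t by (auto simp: conn_def)
  obtain v where v: "v \<in> W (ax i s)" "T (ax i s) (coax i t) v \<noteq> 0" using t by (auto simp: conn_def)
  have ch: "coax i t \<le> h" by (rule coax_le[OF st(2)])
  have sc: "ax i s \<le> coax i t" using st by (simp add: ax_le_iff coax_apply)
  have late: "T (ax i s) (coax i t') w = 0" if "t < t'" "t' \<le> h i" "w \<in> W (ax i s)" for t' w
    using tmax[OF that(1)] that st by (auto simp: conn_def)
  \<comment> \<open>By \<open>late\<close>, \<open>v\<close> is not detected beyond \<open>t\<close>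
    in direction \<open>i\<close>, but it may still be alive at \<open>ax i (Suc t)\<close> and be
    detected in another direction. Subtracting a class from \<open>0\<close> removes this.\<close>
  have "\<exists>v'\<in>W (ax i s). T (ax i s) (coax i t) v' \<noteq> 0 \<and>
      (t < h i \<longrightarrow> T (ax i s) (ax i (Suc t)) v' = 0)"
  proof (cases "t < h i")
    case False
    then show ?thesis using v by blast
  next
    case True
    let ?e = "ax i (h i)"
    have se: "ax i s \<le> ?e" and eh: "?e \<le> h" using st by (auto simp: ax_le_iff ax_apply)
    have sh: "ax i s \<le> h" using se eh by (rule order_trans)
    have "T ?e h (T (ax i s) ?e v) = 0"
      using T_trans[OF se eh order_refl v(1)] late[OF True order_refl v(1)] by (simp add: coax_top)
    from sq_lift[OF T_W[OF se eh v(1)] this] obtain u where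
      u: "u \<in> W (\<lambda>_. 0)" "T (\<lambda>_. 0) ?e u = T (ax i s) ?e v" "T (\<lambda>_. 0) (coax i 0) u = 0" by blast
    let ?u = "T (\<lambda>_. 0) (ax i s) u"
    \<comment> \<open>\<open>u\<close> agrees with \<open>v\<close> at \<open>ax i (h i)\<close>, so
      the difference is undetected in all directions other than \<open>i\<close>; and
      \<open>u\<close> dies at \<open>coax i 0\<close>, so the difference still survives to
      \<open>coax i t\<close>.\<close>
    let ?v = "v - ?u"
    have uW: "?u \<in> W (ax i s)" by (rule T_W[OF bottom_le sh u(1)])
    have vW: "?v \<in> W (ax i s)" by (rule subspace_diff[OF W_subspace[OF sh] v(1) uW])
    have uc: "T (ax i s) (coax i t) ?u = 0"
    proof -
      have c0: "coax i 0 \<le> coax i t" by (auto simp: coax_def le_fun_def)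
      have "T (ax i s) (coax i t) ?u = T (\<lambda>_. 0) (coax i t) u" by (rule T_trans[OF bottom_le sc ch u(1)])
      also have "\<dots> = T (coax i 0) (coax i t) (T (\<lambda>_. 0) (coax i 0) u)"
        by (rule T_trans[OF bottom_le c0 ch u(1), symmetric])
      finally show ?thesis using u(3) T_0[OF c0 ch] by simp
    qed
    have 1: "T (ax i s) (coax i t) ?v \<noteq> 0" using T_diff[OF sc ch] uc v(2) by simp
    let ?p = "ax i (Suc t)"
    have sp: "ax i s \<le> ?p" and ph: "?p \<le> h" and pe: "?p \<le> ?e"
      using st True by (auto simp: ax_le_iff ax_apply)
    have 2: "T (ax i s) ?p ?v = 0"
    proof (rule ccontr)
      assume "T (ax i s) ?p ?v \<noteq> 0"
      from cogen[OF ph T_W[OF sp ph vW] this] obtain j t' where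
        jt: "?p j \<le> t'" "t' \<le> h j" "T ?p (coax j t') (T (ax i s) ?p ?v) \<noteq> 0" by blast
      have pc: "?p \<le> coax j t'" using jt ph by (simp add: le_coax_iff)
      have ch': "coax j t' \<le> h" by (rule coax_le[OF jt(2)])
      have nz: "T (ax i s) (coax j t') ?v \<noteq> 0" using T_trans[OF sp pc ch' vW] jt(3) by simp
      show False
      proof (cases "j = i")
        case True
        then show False using nz late[of t' ?v] vW jt by (simp add: ax_apply)
      next
        case False
        have ec: "?e \<le> coax j t'" using False by (simp add: ax_le_iff coax_apply)
        have "T (ax i s) ?e ?u = T (ax i s) ?e v"
          using T_trans[OF bottom_le se eh u(1)] u(2) by simp
        then have "T (ax i s) ?e ?v = 0" using T_diff[OF se eh] by simp
        then show False using nz T_trans[OF se ec ch' vW] T_0[OF ec ch'] by simp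
      qed
    qed
    show ?thesis using vW 1 2 by blast
  qed
  then obtain v' where v': "v' \<in> W (ax i s)" "T (ax i s) (coax i t) v' \<noteq> 0"
    and v'k: "t < h i \<Longrightarrow> T (ax i s) (ax i (Suc t)) v' = 0" by blast
  have kill: "T (ax i s) x v' = 0" if x: "ax i s \<le> x" "x \<le> h" "\<not> x \<le> coax i t" for x
  proof -
    have xt: "t < x i" using x by (simp add: le_coax_iff)
    then have "t < h i" using x(2) by (auto simp: le_fun_def intro: less_le_trans)
    moreover have "ax i s \<le> ax i (Suc t)" "ax i (Suc t) \<le> x" using st xt by (auto simp: ax_le_iff ax_apply)
    ultimately show ?thesis using T_trans[of "ax i s" "ax i (Suc t)" x v'] T_0[of "ax i (Suc t)" x] v'(1) v'k x(2) by simp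
  qed
  have "T (ax i s) (coax i t) v' \<notin> span (\<Union>x\<in>{x. x \<le> coax i t \<and> \<not> ax i s \<le> x}. T x (coax i t) ` W x)"
  proof
    let ?c = "coax i t"
    let ?V = "\<Union>x\<in>{x. x \<le> ?c \<and> \<not> ax i s \<le> x}. T x ?c ` W x"
    assume inV: "T (ax i s) ?c v' \<in> span ?V"
    have c0: "coax i 0 \<le> ?c" by (auto simp: coax_def le_fun_def)
    have c0h: "coax i 0 \<le> h" by (rule coax_le) simp
    let ?U = "T (coax i 0) ?c ` W (coax i 0)"
    have subU: "subspace ?U" by (rule subspace_image[OF c0 ch])
    \<comment> \<open>The points in question have \<open>i\<close>-th coordinate below
      \<open>s\<close>. Of the axis points generating them, those on the \<open>i\<close>-axis
      contribute nothing at \<open>?c\<close> by minimality of \<open>s\<close>, and those on other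
      axes lie below \<open>coax i 0\<close>.\<close>
    have "?V \<subseteq> ?U"
    proof safe
      fix x w assume x: "x \<le> ?c" "\<not> ax i s \<le> x" and w: "w \<in> W x"
      have xh: "x \<le> h" using x(1) ch by (rule order_trans)
      let ?G = "\<Union>(j, s)\<in>{(j, s). s \<le> x j}. T (ax j s) x ` W (ax j s)"
      have "T x ?c ` ?G \<subseteq> ?U"
      proof safe
        fix j s' y assume s': "s' \<le> x j" and y: "y \<in> W (ax j s')"
        have jx: "ax j s' \<le> x" using s' by (simp add: ax_le_iff)
        have jc: "ax j s' \<le> ?c" using jx x(1) by (rule order_trans)
        have eq: "T x ?c (T (ax j s') x y) = T (ax j s') ?c y" by (rule T_trans[OF jx x(1) ch y])
        show "T x ?c (T (ax j s') x y) \<in> ?U"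
        proof (cases "j = i")
          case True
          then have "s' < s" using s' x(2) by (simp add: ax_le_iff)
          from smin[OF this, of t] have "T (ax j s') ?c y = 0"
            using y True st \<open>s' < s\<close> by (auto simp: conn_def)
          then show ?thesis using eq subspace_0[OF subU] by simp
        next
          case False
          have "s' \<le> h j" using s' xh by (auto simp: le_fun_def intro: order_trans)
          then have j0: "ax j s' \<le> coax i 0" using False by (simp add: ax_le_iff coax_apply)
          have "T x ?c (T (ax j s') x y) = T (coax i 0) ?c (T (ax j s') (coax i 0) y)"
            using eq T_trans[OF j0 c0 ch y] by simp
          then show ?thesis using T_W[OF j0 c0h y] by blast
        qed
      qed
      then have "span (T x ?c ` ?G) \<subseteq> ?U" using subU by (rule span_minimal)
      then show "T x ?c w \<in> ?U" using gen[OF xh] w unfolding T_span[OF x(1) ch, symmetric] by blast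
    qed
    then have "span ?V \<subseteq> ?U" using subU by (rule span_minimal)
    then obtain w where w: "w \<in> W (coax i 0)" "T (ax i s) ?c v' = T (coax i 0) ?c w" using inV by blast
    show False
    proof (cases "s = 0")
      case True
      then have "?V = {}" by (auto simp: ax_le_iff)
      then show False using inV v'(2) by simp
    next
      case False
      let ?t = "ax i t"
      have st': "ax i s \<le> ?t" and tc: "?t \<le> ?c" and th: "?t \<le> h"
        using st by (auto simp: ax_le_iff ax_apply coax_apply)
      have "T ?t ?c (T (ax i s) ?t v') = T (coax i 0) ?c w"
        using T_trans[OF st' tc ch v'(1)] w(2) by simp
      from sq_descend[OF st(2) T_W[OF st' th v'(1)] w(1) this] obtain u
        where "u \<in> W (\<lambda>_. 0)" "T (\<lambda>_. 0) ?c u = T ?t ?c (T (ax i s) ?t v')" by blast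
      then have "conn i 0 t" using bot[OF st(2), of u] T_trans[OF st' tc ch v'(1)] v'(2) by simp
      then show False using smin[of 0 t] False by simp
    qed
  qed
  then have "splits_off (ax i s) (coax i t) v'"
    using sc ch v'(1) kill unfolding splits_off_def by blast
  then show ?thesis by blast
qed

theorem ex_splits_off:
  assumes "x \<le> h" "w \<in> W x" "w \<noteq> 0"
  shows "\<exists>a b v. splits_off a b v"
proof (rule ccontr)
  assume neg: "\<not> ?thesis"
  have "\<exists>a b v. splits_off a b v"
  proof (rule band_splits_off[OF _ _ assms])
    fix x assume "x \<le> h"
    show "W x \<subseteq> span (\<Union>(j, s)\<in>{(j, s). s \<le> x j}. T (ax j s) x ` W (ax j s))"
    proof (rule generated_by_axes[OF subsetI \<open>x \<le> h\<close>], rule ccontr)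
      fix a v assume "a \<le> h" "2 \<le> card {j. 0 < a j}" "v \<in> W a"
        "v \<notin> span (\<Union>j\<in>{j. 0 < a j}. T (a(j := a j - 1)) a ` W (a(j := a j - 1)))"
      from birth_splits_off[OF this] show False using neg by blast
    qed
  next
    fix x v assume x: "x \<le> h" "v \<in> W x" "v \<noteq> 0"
    show "\<exists>i t. x i \<le> t \<and> t \<le> h i \<and> T x (coax i t) v \<noteq> 0"
    proof (rule cogenerated_by_coaxes[OF _ x], rule ccontr)
      fix b v assume "b \<le> h" "2 \<le> card {j. b j < h j}" "v \<in> W b"
        "\<And>j. b j < h j \<Longrightarrow> T b (b(j := Suc (b j))) v = 0" "v \<noteq> 0"
      from death_splits_off[OF this(1-3,5,4)] show False using neg by blast
    qed
  qed
  with neg show False by blast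
qed
end

section \<open>Splitting off a box\<close>

context vector_space begin

lemma vector_space_pair_scalars: "vector_space_pair scale ((*) :: 'a \<Rightarrow> 'a \<Rightarrow> 'a)"
  by unfold_locales (auto simp: algebra_simps)

lemma ex_functional:
  assumes "z \<notin> span U"
  shows "\<exists>\<phi>. Vector_Spaces.linear scale (*) \<phi> \<and> \<phi> z = 1 \<and> (\<forall>y\<in>span U. \<phi> y = 0)"
proof -
  interpret sc: vector_space_pair scale "(*) :: 'a \<Rightarrow> 'a \<Rightarrow> 'a" by (rule vector_space_pair_scalars)
  obtain B where B: "B \<subseteq> U" "independent B" "U \<subseteq> span B"
    using maximal_independent_subset[of U] by auto
  have UB: "span U = span B" using B by (metis span_mono span_span subset_antisym)
  have "independent (insert z B)" using B(2) assms UB by (simp add: independent_insertI)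
  from sc.linear_independent_extend[OF this, of "\<lambda>y. if y = z then 1 else 0"]
  obtain \<phi> where \<phi>: "Vector_Spaces.linear scale (*) \<phi>"
    "\<And>y. y \<in> insert z B \<Longrightarrow> \<phi> y = (if y = z then 1 else 0)" by blast
  have "z \<notin> B" using assms UB span_base by auto
  have "\<phi> y = 0" if "y \<in> span B" for y
  proof (rule sc.linear_eq_0_on_span[OF \<phi>(1) _ that])
    fix x assume "x \<in> B"
    then show "\<phi> x = 0" using \<phi>(2)[of x] \<open>z \<notin> B\<close> by auto
  qed
  then show ?thesis using \<phi> UB by auto
qed

text \<open>The projection \<open>\<rho>\<close> to the kernel along some \<open>b \<in> B\<close>
  with \<open>\<phi> b \<noteq> 0\<close> maps \<open>B\<close> to generators of the kernel and
  sends \<open>b\<close> to \<open>0\<close>, so one generator is saved. This is the drop in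
  dimension when a summand is removed.\<close>

lemma span_kernel_functional:
  assumes "finite B" "Vector_Spaces.linear scale (*) \<phi>" "z \<in> span B" "\<phi> z \<noteq> 0"
  shows "\<exists>B'. finite B' \<and> card B' < card B \<and> span B' = {w \<in> span B. \<phi> w = 0}"
proof -
  interpret sc: vector_space_pair scale "(*) :: 'a \<Rightarrow> 'a \<Rightarrow> 'a" by (rule vector_space_pair_scalars)
  interpret en: vector_space_pair scale scale ..
  obtain b where b: "b \<in> B" "\<phi> b \<noteq> 0"
    using sc.linear_eq_0_on_span[OF assms(2) _ assms(3)] assms(4) by blast
  define \<rho> where "\<rho> w = w - scale (\<phi> w / \<phi> b) b" for w
  have lin: "Vector_Spaces.linear scale scale \<rho>"
    unfolding \<rho>_def Vector_Spaces.linear_iff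
    using sc.linear_add[OF assms(2)] sc.linear_scale[OF assms(2)] vector_space_axioms
    by (simp add: scale_left_distrib add_divide_distrib scale_right_diff_distrib)
  have ker: "\<phi> (\<rho> w) = 0" for w
    using b sc.linear_diff[OF assms(2)] sc.linear_scale[OF assms(2)] by (simp add: \<rho>_def)
  have fixed: "\<rho> w = w" if "\<phi> w = 0" for w using that by (simp add: \<rho>_def)
  have \<rho>b: "\<rho> b = 0" using b by (simp add: \<rho>_def)
  have \<rho>B: "\<rho> w \<in> span B" if "w \<in> span B" for w
    unfolding \<rho>_def using that b(1) by (auto intro!: span_diff span_scale intro: span_base)
  have "span (\<rho> ` (B - {b})) = span (insert 0 (\<rho> ` (B - {b})))" by (simp add: span_insert_0)
  also have "insert 0 (\<rho> ` (B - {b})) = \<rho> ` B" using b(1) \<rho>b by (auto simp: image_iff)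
  also have "span (\<rho> ` B) = \<rho> ` span B" by (rule en.linear_span_image[OF lin])
  also have "\<dots> = {w \<in> span B. \<phi> w = 0}"
    using ker fixed \<rho>B by (force simp: image_iff)
  finally have "span (\<rho> ` (B - {b})) = {w \<in> span B. \<phi> w = 0}" .
  moreover have "card (\<rho> ` (B - {b})) \<le> card (B - {b})" using assms(1) by (simp add: card_image_le)
  moreover have "card (B - {b}) < card B" using assms(1) b(1) by (intro psubset_card_mono) auto
  ultimately show ?thesis using assms(1) by (meson finite_Diff finite_imageI le_less_trans)
qed

end

lemma finite_nat_fun_le:
  fixes h :: "nat \<Rightarrow> nat"
  assumes "finite {i. 0 < h i}"
  shows "finite {x. x \<le> h}"
proof (rule finite_subset)
  let ?D = "{i. 0 < h i}"
  show "finite {f. \<forall>x. (x \<in> ?D \<longrightarrow> f x \<in> (\<Union>i\<in>?D. {..h i})) \<and> (x \<notin> ?D \<longrightarrow> f x = 0)}"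
    using assms by (intro finite_set_of_finite_funs finite_UN_I) auto
  show "{x. x \<le> h} \<subseteq> {f. \<forall>x. (x \<in> ?D \<longrightarrow> f x \<in> (\<Union>i\<in>?D. {..h i})) \<and> (x \<notin> ?D \<longrightarrow> f x = 0)}"
  proof (safe, goal_cases)
    case (1 f x) then show ?case using le_funD[of f h x] by auto
  next
    case (2 f x) then show ?case using le_funD[of f h x] by simp
  qed
qed

section \<open>The natural projection along a box that splits off\<close>

locale split_diagram = diagram +
  fixes a b v \<phi>
  assumes split: "splits_off a b v"
    and \<phi>_linear: "Vector_Spaces.linear scale (*) \<phi>"
    and \<phi>_1: "\<phi> (T a b v) = 1"
    and \<phi>_0: "\<And>y. y \<in> span (\<Union>x\<in>{x. x \<le> b \<and> \<not> a \<le> x}. T x b ` W x) \<Longrightarrow> \<phi> y = 0"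
begin

text \<open>This is the natural map to the interval module of \<open>{a..b}\<close>; multiples of
  \<open>T a x v\<close> form the image of its section, and \<open>rest\<close> is its
  kernel.\<close>

definition coeff :: "(nat \<Rightarrow> nat) \<Rightarrow> 'b \<Rightarrow> 'a" where
  "coeff x w = (if a \<le> x \<and> x \<le> b then \<phi> (T x b w) else 0)"

definition proj :: "(nat \<Rightarrow> nat) \<Rightarrow> 'b \<Rightarrow> 'b" where
  "proj x w = w - coeff x w *s T a x v"

definition rest :: "(nat \<Rightarrow> nat) \<Rightarrow> 'b set" where
  "rest x = {w \<in> W x. coeff x w = 0}"

sublocale sc: vector_space_pair scale "(*) :: 'a \<Rightarrow> 'a \<Rightarrow> 'a" by (rule vector_space_pair_scalars)

lemma b_le: "b \<le> h" and a_le_b: "a \<le> b" and v_in: "v \<in> W a" and a_le: "a \<le> h"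
  using split order_trans unfolding splits_off_def by auto

lemma v_kill: "a \<le> x \<Longrightarrow> x \<le> h \<Longrightarrow> \<not> x \<le> b \<Longrightarrow> T a x v = 0"
  using split unfolding splits_off_def by auto

lemma coeff_linear: "Vector_Spaces.linear scale (*) (coeff x)"
proof (cases "a \<le> x \<and> x \<le> b")
  case True
  have "Vector_Spaces.linear scale (*) (\<phi> \<circ> T x b)"
    using True b_le by (intro Vector_Spaces.linear_compose[OF _ \<phi>_linear] T_linear) auto
  then show ?thesis using True by (simp add: coeff_def[abs_def] o_def)
next
  case False
  then show ?thesis by (simp add: coeff_def[abs_def] sc.linear_zero if_not_P cong: if_cong)
qed

lemma coeff_v: "a \<le> x \<Longrightarrow> x \<le> b \<Longrightarrow> coeff x (T a x v) = 1"
  using T_trans[OF _ _ b_le v_in] \<phi>_1 by (simp add: coeff_def)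

text \<open>The critical case is a map that enters the box from a point not above \<open>a\<close>:
  its image at \<open>b\<close> lies in the span on which \<open>\<phi>\<close> vanishes.\<close>

lemma coeff_T:
  assumes "x \<le> y" "y \<le> h" "w \<in> W x"
  shows "coeff y (T x y w) = (if (a \<le> x \<and> x \<le> b) \<and> a \<le> y \<and> y \<le> b then coeff x w else 0)"
proof (cases "a \<le> y \<and> y \<le> b")
  case y: True
  have xb: "x \<le> b" using assms(1) y order_trans by blast
  have eq: "coeff y (T x y w) = \<phi> (T x b w)"
    using y T_trans[OF assms(1) _ b_le assms(3)] by (simp add: coeff_def)
  show ?thesis
  proof (cases "a \<le> x")
    case True
    then show ?thesis using eq y xb by (simp add: coeff_def)
  next
    case False
    then have "\<phi> (T x b w) = 0" using xb assms(3) by (intro \<phi>_0 span_base) auto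
    then show ?thesis using eq False by simp
  qed
qed (simp add: coeff_def if_not_P)

lemma proj_linear:
  assumes "x \<le> h"
  shows "Vector_Spaces.linear scale scale (proj x)"
  unfolding proj_def[abs_def] Vector_Spaces.linear_iff
  using sc.linear_add[OF coeff_linear] sc.linear_scale[OF coeff_linear] vector_space_axioms
  by (simp add: scale_left_distrib scale_right_diff_distrib)

lemma v_W: "a \<le> x \<Longrightarrow> x \<le> h \<Longrightarrow> T a x v \<in> W x"
  by (rule T_W[OF _ _ v_in])

lemma proj_outside: "\<not> (a \<le> x \<and> x \<le> b) \<Longrightarrow> proj x w = w"
  by (simp add: proj_def coeff_def if_not_P)

lemma proj_in_rest:
  assumes "x \<le> h" "w \<in> W x"
  shows "proj x w \<in> rest x"
proof (cases "a \<le> x \<and> x \<le> b")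
  case True
  have "proj x w \<in> W x" unfolding proj_def
    using True assms v_W by (intro subspace_diff subspace_scale W_subspace) auto
  moreover have "coeff x (proj x w) = 0"
    using True coeff_v sc.linear_diff[OF coeff_linear] sc.linear_scale[OF coeff_linear]
    by (simp add: proj_def)
  ultimately show ?thesis by (simp add: rest_def)
next
  case False
  then show ?thesis using assms by (simp add: proj_outside rest_def coeff_def if_not_P)
qed

lemma proj_rest: "w \<in> rest x \<Longrightarrow> proj x w = w"
  by (simp add: rest_def proj_def)

lemma rest_subset: "rest x \<subseteq> W x"
  by (auto simp: rest_def)

text \<open>Given naturality of \<open>coeff\<close>, the critical case is a map that leaves the
  box: \<open>coeff\<close> drops to \<open>0\<close>, and \<open>T a y v\<close> is
  \<open>0\<close> as well because \<open>v\<close> dies there.\<close>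

lemma proj_T:
  assumes "x \<le> y" "y \<le> h" "w \<in> W x"
  shows "proj y (T x y w) = T x y (proj x w)"
proof -
  have "T x y (proj x w) = T x y w - coeff x w *s T x y (T a x v)"
    using T_diff[OF assms(1,2)] T_scale[OF assms(1,2)] by (simp add: proj_def)
  also have "coeff x w *s T x y (T a x v) = coeff y (T x y w) *s T a y v"
  proof (cases "a \<le> x \<and> x \<le> b")
    case True
    have ay: "a \<le> y" using True assms(1) order_trans by blast
    have "T x y (T a x v) = T a y v" using T_trans[OF _ assms(1,2) v_in] True by blast
    then show ?thesis using True coeff_T[OF assms] v_kill[OF ay assms(2)] ay by auto
  next
    case False
    then have "coeff x w = 0" by (auto simp: coeff_def)
    moreover have "coeff y (T x y w) = 0" using False coeff_T[OF assms] by auto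
    ultimately show ?thesis by simp
  qed
  finally show ?thesis by (simp add: proj_def)
qed

lemma rest_subspace: "x \<le> h \<Longrightarrow> subspace (rest x)"
  unfolding subspace_def rest_def
  using W_subspace[of x] sc.linear_0[OF coeff_linear] sc.linear_add[OF coeff_linear]
    sc.linear_scale[OF coeff_linear]
  by (simp add: subspace_0 subspace_add subspace_scale)

lemma T_rest:
  assumes "x \<le> y" "y \<le> h" "w \<in> rest x"
  shows "T x y w \<in> rest y"
proof -
  have w: "w \<in> W x" using assms(3) rest_subset by blast
  have "T x y w = proj y (T x y w)" using proj_T[OF assms(1,2) w] proj_rest[OF assms(3)] by simp
  then show ?thesis using proj_in_rest[OF assms(2) T_W[OF assms(1,2) w]] by simp
qed

text \<open>\<open>proj\<close> commutes with the maps and fixes \<open>rest\<close>. Applied to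
  witnesses in \<open>W\<close> it yields witnesses in \<open>rest\<close>, so lifting and
  descending are inherited.\<close>

lemma rest_diagram: "diagram scale h N T rest"
proof (intro diagram.intro diagram_axioms.intro vector_space_axioms, goal_cases)
  case 1 show ?case by (rule fin_dir)
next
  case 2 show ?case by (rule card_dir)
next
  case (3 x y) then show ?case by (rule T_linear)
next
  case (4 x) then show ?case by (rule rest_subspace)
next
  case (5 x y v) then show ?case by (rule T_rest)
next
  case (6 x v) then show ?case using T_id rest_subset by blast
next
  case (7 x y z v) then show ?case using T_trans rest_subset by blast
next
  case (8 p q L l v' g)
  have ph: "p \<le> h" using 8(1,2) by (rule order_trans)
  have pm: "p \<le> mix g p q A" for A using 8(1) by (auto simp: mix_def le_fun_def)
  have mh: "mix g p q A \<le> h" for A using ph 8(2) by (auto simp: mix_def le_fun_def)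
  have "v' \<in> W (mix g p q {l})" using 8(7) rest_subset by blast
  from lift[OF 8(1-6) this 8(8)] obtain w where w: "w \<in> W p" "T p (mix g p q {l}) w = v'"
    "\<And>j. j \<in> L - {l} \<Longrightarrow> T p (mix g p q {j}) w = 0" by blast
  have "T p (mix g p q {l}) (proj p w) = v'"
    using proj_T[OF pm mh w(1)] w(2) proj_rest[OF 8(7)] by metis
  moreover have "T p (mix g p q {j}) (proj p w) = 0" if "j \<in> L - {l}" for j
    using proj_T[OF pm mh w(1), of "{j}"] w(3)[OF that] endo.linear_0[OF proj_linear[OF mh]] by metis
  ultimately show ?case using proj_in_rest[OF ph w(1)] by blast
next
  case (9 p q L l v' g)
  have ph: "p \<le> h" using 9(1,2) by (rule order_trans)
  have mm: "mix g p q A \<le> mix g p q A'" if "A \<subseteq> A'" for A A' by (rule mix_mono[OF 9(1) that])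
  have mh: "mix g p q A \<le> h" for A using ph 9(2) by (auto simp: mix_def le_fun_def)
  let ?y = "mix g p q (L - {l})"
  let ?V = "\<lambda>W. \<Union>j\<in>L - {l}. T (mix g p q (L - {l, j})) ?y ` W (mix g p q (L - {l, j}))"
  have v: "v' \<in> W ?y" using 9(7) rest_subset by blast
  have "(\<Union>j\<in>L - {l}. T (mix g p q (L - {j})) (mix g p q L) ` rest (mix g p q (L - {j})))
    \<subseteq> (\<Union>j\<in>L - {l}. T (mix g p q (L - {j})) (mix g p q L) ` W (mix g p q (L - {j})))"
    using rest_subset by blast
  from span_mono[OF this] 9(8)
  have "v' \<in> span (?V W)" by (intro descend[OF 9(1-6) v]) blast
  then have "proj ?y v' \<in> span (proj ?y ` ?V W)"
    using endo.linear_span_image[OF proj_linear[OF mh]] by blast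
  also have "proj ?y ` ?V W \<subseteq> ?V rest"
  proof
    fix z assume "z \<in> proj ?y ` ?V W"
    then obtain j w where j: "j \<in> L - {l}" and w: "w \<in> W (mix g p q (L - {l, j}))"
      and z: "z = proj ?y (T (mix g p q (L - {l, j})) ?y w)" by blast
    have le: "mix g p q (L - {l, j}) \<le> ?y" by (rule mm) auto
    have "proj ?y (T (mix g p q (L - {l, j})) ?y w) \<in>
      T (mix g p q (L - {l, j})) ?y ` rest (mix g p q (L - {l, j}))"
      using proj_T[OF le mh w] proj_in_rest[OF mh w] by (metis imageI)
    then show "z \<in> ?V rest" unfolding z using j by blast
  qed
  then have "span (proj ?y ` ?V W) \<subseteq> span (?V rest)" by (rule span_mono)
  finally show ?case using proj_rest[OF 9(7)] by simp
qed

end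

text \<open>An isomorphism with a sum of \<open>M\<close> interval modules of boxes, written through
  its components: the third condition is naturality, and unique solvability in the last one is
  bijectivity at \<open>x\<close>, with coordinates of boxes not containing \<open>x\<close> set to
  \<open>0\<close>.\<close>

definition box_basis ::
  "('f::field \<Rightarrow> 'b::ab_group_add \<Rightarrow> 'b) \<Rightarrow> (nat \<Rightarrow> nat) \<Rightarrow> ((nat \<Rightarrow> nat) \<Rightarrow> (nat \<Rightarrow> nat) \<Rightarrow> 'b \<Rightarrow> 'b) \<Rightarrow>
   ((nat \<Rightarrow> nat) \<Rightarrow> 'b set) \<Rightarrow> nat \<Rightarrow> (nat \<Rightarrow> (nat \<Rightarrow> nat) set) \<Rightarrow> (nat \<Rightarrow> (nat \<Rightarrow> nat) \<Rightarrow> 'b \<Rightarrow> 'f) \<Rightarrow> bool"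
  where "box_basis scale h T W M I \<kappa> \<longleftrightarrow>
    (\<forall>m<M. \<exists>a b. a \<le> b \<and> b \<le> h \<and> I m = {a..b}) \<and>
    (\<forall>m<M. \<forall>x\<le>h. Vector_Spaces.linear scale (*) (\<kappa> m x)) \<and>
    (\<forall>m<M. \<forall>y\<le>h. \<forall>x\<le>y. \<forall>w\<in>W x.
      \<kappa> m y (T x y w) = (if x \<in> I m \<and> y \<in> I m then \<kappa> m x w else 0)) \<and>
    (\<forall>x\<le>h. \<forall>c. (\<forall>m<M. x \<notin> I m \<longrightarrow> c m = 0) \<longrightarrow> (\<exists>!w. w \<in> W x \<and> (\<forall>m<M. \<kappa> m x w = c m)))"

text \<open>The old functionals are composed with \<open>proj\<close>, which removes the new
  summand. The vector with prescribed coordinates is the old solution in \<open>rest\<close> plus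
  \<open>c M\<close> times the image of \<open>v\<close>; outside the box \<open>c M\<close> is
  \<open>0\<close>.\<close>

lemma (in split_diagram) box_basis_extend:
  assumes "box_basis scale h T rest M I \<kappa>"
  shows "box_basis scale h T W (Suc M) (I(M := {a..b}))
    (\<lambda>m x. if m = M then coeff x else \<kappa> m x \<circ> proj x)"
  unfolding box_basis_def
proof (intro conjI allI impI ballI, goal_cases)
  case (1 m)
  then show ?case using assms a_le_b b_le unfolding box_basis_def by (auto simp: less_Suc_eq)
next
  case (2 m x)
  show ?case
  proof (cases "m = M")
    case False
    then have "Vector_Spaces.linear scale (*) (\<kappa> m x)" using assms 2 unfolding box_basis_def by auto
    from Vector_Spaces.linear_compose[OF proj_linear[OF 2(2)] this] False show ?thesis by simp
  qed (simp add: coeff_linear)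
next
  case (3 m y x w)
  show ?case
  proof (cases "m = M")
    case True
    then show ?thesis using coeff_T[OF 3(3,2,4)] by simp
  next
    case False
    have xh: "x \<le> h" using 3(3,2) by (rule order_trans)
    have "\<kappa> m y (T x y (proj x w)) = (if x \<in> I m \<and> y \<in> I m then \<kappa> m x (proj x w) else 0)"
      using assms 3 False proj_in_rest[OF xh 3(4)] unfolding box_basis_def by auto
    then show ?thesis using False proj_T[OF 3(3,2,4)] by simp
  qed
next
  case (4 x c)
  have ex1: "\<exists>!w. w \<in> rest x \<and> (\<forall>m<M. \<kappa> m x w = c m)"
    using assms 4 unfolding box_basis_def by (auto simp: less_Suc_eq)
  then obtain w where w: "w \<in> rest x" "\<And>m. m < M \<Longrightarrow> \<kappa> m x w = c m" by blast
  have wW: "w \<in> W x" using w rest_subset by blast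
  let ?w = "w + c M *s T a x v"
  have cM: "c M = 0" if "\<not> (a \<le> x \<and> x \<le> b)" using 4(2) that by auto
  have c_ok: "coeff x ?w = c M"
  proof (cases "a \<le> x \<and> x \<le> b")
    case True
    then show ?thesis using w(1) coeff_v sc.linear_add[OF coeff_linear] sc.linear_scale[OF coeff_linear]
      by (simp add: rest_def)
  next
    case False
    then show ?thesis using cM w(1) by (simp add: rest_def)
  qed
  have pw: "proj x ?w = w" by (simp add: proj_def c_ok)
  have wW': "?w \<in> W x"
  proof (cases "a \<le> x \<and> x \<le> b")
    case True
    then show ?thesis using wW v_W 4(1) by (intro subspace_add subspace_scale W_subspace) auto
  next
    case False
    then show ?thesis using cM wW by simp
  qed
  show ?case
  proof (rule ex1I[of _ ?w])
    show "?w \<in> W x \<and> (\<forall>m<Suc M. (if m = M then coeff x else \<kappa> m x \<circ> proj x) ?w = c m)"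
      using wW' c_ok pw w(2) by (auto simp: less_Suc_eq)
  next
    fix y assume y: "y \<in> W x \<and> (\<forall>m<Suc M. (if m = M then coeff x else \<kappa> m x \<circ> proj x) y = c m)"
    have cy: "coeff x y = c M" using y[THEN conjunct2, rule_format, of M] by simp
    have "\<kappa> m x (proj x y) = c m" if "m < M" for m
      using y[THEN conjunct2, rule_format, of m] that by simp
    moreover have "proj x y \<in> rest x" using proj_in_rest[OF 4(1)] y by blast
    ultimately have "proj x y = w" using ex1 w by blast
    then show "y = ?w" using cy by (simp add: proj_def algebra_simps)
  qed
qed

context vector_space begin

text \<open>Induction on the total dimension over the finitely many points below \<open>h\<close>:
  passing to \<open>rest\<close> raises it nowhere and lowers it at \<open>a\<close>, where
  \<open>v\<close> has coefficient \<open>1\<close>.\<close>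

theorem ex_box_basis:
  assumes "diagram scale h N T W"
    and "\<And>x. x \<le> h \<Longrightarrow> \<exists>B. finite B \<and> span B = W x"
  shows "\<exists>M I \<kappa>. box_basis scale h T W M I \<kappa>"
proof -
  \<comment> \<open>The least size of a finite generating set plays the part of the
    dimension.\<close>
  define d where "d A = (LEAST n. \<exists>B. finite B \<and> card B = n \<and> span B = A)" for A
  have d_le: "d A \<le> card B" if "finite B" "span B = A" for A B
    unfolding d_def by (rule Least_le) (use that in blast)
  have d_ex: "\<exists>B. finite B \<and> card B = d A \<and> span B = A" if "finite B" "span B = A" for A B
    unfolding d_def by (rule LeastI[of _ "card B"]) (use that in blast)
  show ?thesis using assms
  proof (induction "\<Sum>x | x \<le> h. d (W x)" arbitrary: W rule: less_induct)
    case less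
    interpret diagram scale h N T W by (rule less.prems)
    show ?case
    proof (cases "\<forall>x\<le>h. W x \<subseteq> {0}")
      case True
      have "W x = {0}" if "x \<le> h" for x using True subspace_0[OF W_subspace[OF that]] that by auto
      then have "box_basis scale h T W 0 (\<lambda>_. {}) (\<lambda>_ _ _. 0)" by (simp add: box_basis_def)
      then show ?thesis by blast
    next
      case False
      then obtain a b v where abv: "splits_off a b v" using ex_splits_off by blast
      then have "T a b v \<notin> span (\<Union>x\<in>{x. x \<le> b \<and> \<not> a \<le> x}. T x b ` W x)"
        unfolding splits_off_def by blast
      from ex_functional[OF this] obtain \<phi> where \<phi>: "Vector_Spaces.linear scale (*) \<phi>" "\<phi> (T a b v) = 1"
        "\<And>y. y \<in> span (\<Union>x\<in>{x. x \<le> b \<and> \<not> a \<le> x}. T x b ` W x) \<Longrightarrow> \<phi> y = 0"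
        by blast
      interpret split_diagram scale h N T W a b v \<phi>
        by (intro split_diagram.intro split_diagram_axioms.intro less.prems(1) abv \<phi>)
      have small: "\<exists>B. finite B \<and> span B = rest x \<and> card B \<le> d (W x) \<and> (x = a \<longrightarrow> card B < d (W x))"
        if x: "x \<le> h" for x
      proof -
        obtain B where B: "finite B" "card B = d (W x)" "span B = W x"
          using less.prems(2)[OF x] d_ex by metis
        show ?thesis
        proof (cases "a \<le> x \<and> x \<le> b")
          case True
          then have "T a x v \<in> span B" "coeff x (T a x v) \<noteq> 0" using B(3) v_W x coeff_v by auto
          from span_kernel_functional[OF B(1) coeff_linear this] obtain B' where
            "finite B'" "card B' < card B" "span B' = rest x" using B(3) unfolding rest_def by auto
          then show ?thesis using B(2) by (intro exI[of _ B']) auto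
        next
          case False
          then have "rest x = W x" "x \<noteq> a" using a_le_b by (auto simp: rest_def coeff_def)
          then show ?thesis using B by (intro exI[of _ B]) simp
        qed
      qed
      have le: "d (rest x) \<le> d (W x)" if x: "x \<le> h" for x
      proof -
        from small[OF x] obtain B where B: "finite B" "span B = rest x" "card B \<le> d (W x)" by blast
        from d_le[OF B(1,2)] B(3) show ?thesis by (rule order_trans)
      qed
      have lt: "d (rest a) < d (W a)" 
      proof -
        from small[OF a_le] obtain B where B: "finite B" "span B = rest a" "card B < d (W a)" by blast
        from d_le[OF B(1,2)] B(3) show ?thesis by (rule le_less_trans)
      qed
      have "(\<Sum>x | x \<le> h. d (rest x)) < (\<Sum>x | x \<le> h. d (W x))"
        using le lt a_le finite_nat_fun_le[OF fin_dir] by (intro sum_strict_mono_ex1) auto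
      from less.hyps[OF this rest_diagram] small obtain M I \<kappa> where "box_basis scale h T rest M I \<kappa>"
        by meson
      from box_basis_extend[OF this] show ?thesis by blast
    qed
  qed
qed
end

section \<open>Koszul complexes in degrees \<open>1\<close> and \<open>k - 1\<close>\<close>

lemma koszul_index_all: "koszul_index k k = {{}}"
  by (auto simp: koszul_index_def dest: finite_subset)

lemma koszul_index_0: "koszul_index k 0 = {{..<k}}"
proof -
  have "S = {..<k}" if "S \<subseteq> {..<k}" "card S = k" for S
    using card_subset_eq[OF _ that(1)] that(2) by simp
  then show ?thesis by (auto simp: koszul_index_def)
qed

lemma finite_koszul_index: "finite (koszul_index k i)"
  unfolding koszul_index_def by simp

lemma carrier_koszul_space:
  "carrier (koszul_space F k X i) = (\<Pi>\<^sub>E S\<in>koszul_index k i. carrier (Ob F (X S)))"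
  by (simp add: koszul_space_def module_sum_def finite_koszul_index)

lemma zero_koszul_space:
  "\<zero>\<^bsub>koszul_space F k X i\<^esub> = (\<lambda>S\<in>koszul_index k i. \<zero>\<^bsub>Ob F (X S)\<^esub>)"
  by (simp add: koszul_space_def module_sum_def)

lemma sorted_nth_in:
  assumes "S \<subseteq> {..<k}" "card S = k - i" "j < i" "i \<le> k"
  shows "sorted_list_of_set ({..<k} - S) ! j \<in> {..<k} - S"
proof -
  have "length (sorted_list_of_set ({..<k} - S)) = i"
    using assms by (simp add: card_Diff_subset finite_subset[OF assms(1)])
  then have "sorted_list_of_set ({..<k} - S) ! j \<in> set (sorted_list_of_set ({..<k} - S))"
    using assms(3) by (metis nth_mem)
  then show ?thesis by simp
qed

locale vfunctor_on =
  fixes P :: "'p set" and r :: "'p rel" and F :: "('p, 'f::field, 'v) vfunctor"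
  assumes functorial: "is_vfunctor P r F"
begin

lemma Ob_vectorspace: "x \<in> P \<Longrightarrow> vectorspace (class_ring :: 'f ring) (Ob F x)"
  using functorial by (simp add: is_vfunctor_def)

lemma Mor_linear: "(x, y) \<in> r \<Longrightarrow> linear_map (class_ring :: 'f ring) (Ob F x) (Ob F y) (Mor F x y)"
  using functorial by (simp add: is_vfunctor_def)

lemma Mor_id: "x \<in> P \<Longrightarrow> v \<in> carrier (Ob F x) \<Longrightarrow> Mor F x x v = v"
  using functorial by (simp add: is_vfunctor_def)

lemma Mor_trans:
  "(x, y) \<in> r \<Longrightarrow> (y, z) \<in> r \<Longrightarrow> v \<in> carrier (Ob F x) \<Longrightarrow> Mor F y z (Mor F x y v) = Mor F x z v"
  using functorial by (simp add: is_vfunctor_def)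

lemma Mor_closed: "(x, y) \<in> r \<Longrightarrow> v \<in> carrier (Ob F x) \<Longrightarrow> Mor F x y v \<in> carrier (Ob F y)"
  using mod_hom.f_im[OF linear_map.axioms(3)[OF Mor_linear]] by blast

lemma Mor_add: "(x, y) \<in> r \<Longrightarrow> v \<in> carrier (Ob F x) \<Longrightarrow> w \<in> carrier (Ob F x) \<Longrightarrow>
    Mor F x y (v \<oplus>\<^bsub>Ob F x\<^esub> w) = Mor F x y v \<oplus>\<^bsub>Ob F y\<^esub> Mor F x y w"
  using LinearCombinations.module_hom_add[OF mod_hom.f_hom[OF linear_map.axioms(3)[OF Mor_linear]]] by blast

lemma Mor_smult: "(x, y) \<in> r \<Longrightarrow> v \<in> carrier (Ob F x) \<Longrightarrow>
    Mor F x y (c \<odot>\<^bsub>Ob F x\<^esub> v) = c \<odot>\<^bsub>Ob F y\<^esub> Mor F x y v"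
  using LinearCombinations.module_hom_smult[OF mod_hom.f_hom[OF linear_map.axioms(3)[OF Mor_linear]], of x y c v] by simp

lemma Mor_zero: "(x, y) \<in> r \<Longrightarrow> Mor F x y \<zero>\<^bsub>Ob F x\<^esub> = \<zero>\<^bsub>Ob F y\<^esub>"
  using mod_hom.f0_is_0[OF linear_map.axioms(3)[OF Mor_linear]] by blast

lemma Ob_module: "x \<in> P \<Longrightarrow> Module.module (class_ring :: 'f ring) (Ob F x)"
  using Ob_vectorspace vectorspace.axioms by blast

lemma Ob_abelian_group: "x \<in> P \<Longrightarrow> abelian_group (Ob F x)"
  using Ob_module Module.module.axioms by blast

lemma Ob_abelian_monoid: "x \<in> P \<Longrightarrow> abelian_monoid (Ob F x)"
  using Ob_abelian_group abelian_group.axioms by blast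

lemma Ob_zero: "x \<in> P \<Longrightarrow> \<zero>\<^bsub>Ob F x\<^esub> \<in> carrier (Ob F x)"
  using abelian_monoid.zero_closed[OF Ob_abelian_monoid] by blast

lemma Ob_smult: "x \<in> P \<Longrightarrow> v \<in> carrier (Ob F x) \<Longrightarrow> (c :: 'f) \<odot>\<^bsub>Ob F x\<^esub> v \<in> carrier (Ob F x)"
  using Module.module.smult_closed[OF Ob_module, of x c v] by simp

lemma Ob_smult_zero: "x \<in> P \<Longrightarrow> (c :: 'f) \<odot>\<^bsub>Ob F x\<^esub> \<zero>\<^bsub>Ob F x\<^esub> = \<zero>\<^bsub>Ob F x\<^esub>"
  using Module.module.smult_r_null[OF Ob_module, of x c] by simp

lemma Ob_sign_sign:
  assumes "x \<in> P" "v \<in> carrier (Ob F x)"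
  shows "((- 1) ^ j :: 'f) \<odot>\<^bsub>Ob F x\<^esub> ((- 1) ^ j \<odot>\<^bsub>Ob F x\<^esub> v) = v"
proof -
  have "((- 1) ^ j * (- 1) ^ j :: 'f) = 1" by (simp flip: power_add mult_2)
  then show ?thesis
    using Module.module.smult_assoc1[OF Ob_module[OF assms(1)], of "(- 1) ^ j" "(- 1) ^ j" v]
      Module.module.smult_one[OF Ob_module[OF assms(1)], of v] assms by simp
qed

lemma finsum_all_zero:
  assumes "x \<in> P" "\<And>a. a \<in> A \<Longrightarrow> f a = \<zero>\<^bsub>Ob F x\<^esub>"
  shows "finsum (Ob F x) f A = \<zero>\<^bsub>Ob F x\<^esub>"
proof -
  interpret abelian_monoid "Ob F x" by (rule Ob_abelian_monoid[OF assms(1)])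
  have "finsum (Ob F x) f A = finsum (Ob F x) (\<lambda>_. \<zero>\<^bsub>Ob F x\<^esub>) A"
    using assms(2) by (intro finsum_cong') auto
  then show ?thesis by simp
qed

text \<open>Degree \<open>k - 1\<close> is indexed by singletons and degree \<open>k\<close> by the
  empty set alone, so a cycle concentrated at \<open>{l}\<close> is the boundary of a single vector
  at the initial vertex.\<close>

lemma koszul_lift:
  assumes "strongly_bicartesian P r k X" "middle_exact P r k F" "2 \<le> k" "l < k"
    and v: "v \<in> carrier (Ob F (X {l}))"
    and kill: "\<And>j. j < k \<Longrightarrow> j \<noteq> l \<Longrightarrow> Mor F (X {l}) (X {l, j}) v = \<zero>\<^bsub>Ob F (X {l, j})\<^esub>"
  shows "\<exists>w\<in>carrier (Ob F (X {})). Mor F (X {}) (X {l}) w = v \<and>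
    (\<forall>j<k. j \<noteq> l \<longrightarrow> Mor F (X {}) (X {j}) w = \<zero>\<^bsub>Ob F (X {j})\<^esub>)"
proof -
  have XP: "X A \<in> P" if "A \<subseteq> {..<k}" for A
    using assms(1) that by (auto simp: strongly_bicartesian_def cube_def)
  have Xr: "(X A, X B) \<in> r" if "A \<subseteq> B" "B \<subseteq> {..<k}" for A B
    using assms(1) that by (auto simp: strongly_bicartesian_def cube_def)
  define c where "c = (\<lambda>A\<in>koszul_index k (k - 1). if A = {l} then v else \<zero>\<^bsub>Ob F (X A)\<^esub>)"
  have c: "c \<in> carrier (koszul_space F k X (k - 1))"
    unfolding c_def carrier_koszul_space using v by (auto simp: koszul_index_def intro!: Ob_zero XP)
  have "koszul_diff F k X (k - 1) c = \<zero>\<^bsub>koszul_space F k X (k - 1 - 1)\<^esub>"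
    unfolding koszul_diff_def zero_koszul_space
  proof (rule restrict_ext)
    fix B assume "B \<in> koszul_index k (k - 1 - 1)"
    then have B: "B \<subseteq> {..<k}" by (simp add: koszul_index_def)
    show "finsum (Ob F (X B)) (\<lambda>(A, j). (- 1) ^ j \<odot>\<^bsub>Ob F (X B)\<^esub> Mor F (X A) (X B) (c A))
      {(A, j). A \<in> koszul_index k (k - 1) \<and> j < k - 1 \<and> B = A \<union> {sorted_list_of_set ({..<k} - A) ! j}}
      = \<zero>\<^bsub>Ob F (X B)\<^esub>"
    proof (rule finsum_all_zero[OF XP[OF B]], clarify)
      fix A j assume A: "A \<in> koszul_index k (k - 1)" "j < k - 1"
        "B = A \<union> {sorted_list_of_set ({..<k} - A) ! j}"
      let ?t = "sorted_list_of_set ({..<k} - A) ! j"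
      have t: "?t \<in> {..<k} - A" using A by (intro sorted_nth_in[where i = "k - 1"]) (auto simp: koszul_index_def)
      have AB: "A \<subseteq> B" using A by auto
      have "Mor F (X A) (X B) (c A) = \<zero>\<^bsub>Ob F (X B)\<^esub>"
      proof (cases "A = {l}")
        case True
        then have "B = {l, ?t}" using A by auto
        then show ?thesis using kill[of ?t] t A(1) True by (auto simp: c_def)
      next
        case False
        then show ?thesis using A(1) Mor_zero[OF Xr[OF AB B]] by (simp add: c_def)
      qed
      then show "(- 1) ^ j \<odot>\<^bsub>Ob F (X (A \<union> {?t}))\<^esub> Mor F (X A) (X (A \<union> {?t})) (c A) = \<zero>\<^bsub>Ob F (X (A \<union> {?t}))\<^esub>"
        using Ob_smult_zero[OF XP[OF B]] A(3) by simp
    qed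
  qed
  moreover have "koszul_homology_trivial F k X (k - 1)"
    using assms(1-3) by (simp add: middle_exact_def)
  ultimately have "c \<in> koszul_diff F k X k ` carrier (koszul_space F k X k)"
    using c assms(3) unfolding koszul_homology_trivial_def by auto
  then obtain c' where c': "c' \<in> carrier (koszul_space F k X k)" "c = koszul_diff F k X k c'" by blast
  let ?w = "c' {}"
  have w: "?w \<in> carrier (Ob F (X {}))" using c'(1) by (auto simp: carrier_koszul_space koszul_index_all)
  \<comment> \<open>The complement of the empty set is listed as \<open>0, ..., k - 1\<close>, so
    position \<open>j\<close> holds the element \<open>j\<close> and the sum has one term.\<close>
  have cj: "c {j} = (- 1) ^ j \<odot>\<^bsub>Ob F (X {j})\<^esub> Mor F (X {}) (X {j}) ?w" if j: "j < k" for j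
  proof -
    have jP: "X {j} \<in> P" and jr: "(X {}, X {j}) \<in> r" using j by (auto intro!: XP Xr)
    interpret abelian_monoid "Ob F (X {j})" by (rule Ob_abelian_monoid[OF jP])
    have "{(A, i). A \<in> koszul_index k k \<and> i < k \<and> {j} = A \<union> {sorted_list_of_set ({..<k} - A) ! i}} = {({}, j)}"
      using j by (auto simp: koszul_index_all lessThan_atLeast0)
    moreover have "{j} \<in> koszul_index k (k - 1)" using j by (simp add: koszul_index_def)
    moreover have "(- 1) ^ j \<odot>\<^bsub>Ob F (X {j})\<^esub> Mor F (X {}) (X {j}) ?w \<in> carrier (Ob F (X {j}))"
      by (intro Ob_smult jP Mor_closed[OF jr w])
    ultimately show ?thesis unfolding c'(2) koszul_diff_def by simp
  qed
  \<comment> \<open>The boundary carries the sign of position \<open>l\<close> at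
    \<open>{l}\<close>; the same sign cancels it, and zeros at the other vertices stay
    zeros.\<close>
  let ?w' = "(- 1) ^ l \<odot>\<^bsub>Ob F (X {})\<^esub> ?w"
  have "?w' \<in> carrier (Ob F (X {}))" using w by (intro Ob_smult XP) auto
  moreover have "Mor F (X {}) (X {l}) ?w' = v"
  proof -
    have "(X {}, X {l}) \<in> r" using assms(4) by (intro Xr) auto
    then have "Mor F (X {}) (X {l}) ?w' = c {l}" using Mor_smult w cj[OF assms(4)] by simp
    also have "c {l} = v" using assms(4) by (simp add: c_def koszul_index_def)
    finally show ?thesis .
  qed
  moreover have "Mor F (X {}) (X {j}) ?w' = \<zero>\<^bsub>Ob F (X {j})\<^esub>" if j: "j < k" "j \<noteq> l" for j
  proof -
    have jP: "X {j} \<in> P" and jr: "(X {}, X {j}) \<in> r" using j by (auto intro!: XP Xr)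
    have "c {j} = \<zero>\<^bsub>Ob F (X {j})\<^esub>" using j by (simp add: c_def koszul_index_def)
    then have "Mor F (X {}) (X {j}) ?w = (- 1) ^ j \<odot>\<^bsub>Ob F (X {j})\<^esub> \<zero>\<^bsub>Ob F (X {j})\<^esub>"
      using cj[OF j(1)] Ob_sign_sign[OF jP Mor_closed[OF jr w]] by metis
    then show ?thesis using Mor_smult[OF jr w] Ob_smult_zero[OF jP] by simp
  qed
  ultimately show ?thesis by blast
qed

text \<open>Vectors at the vertices next to the top whose images sum to zero form a cycle of degree
  \<open>1\<close>, where the only position is \<open>0\<close> and the sign is \<open>+1\<close>.
  At the vertex lacking \<open>l\<close>, a boundary from degree \<open>2\<close> collects
  contributions from vertices lacking \<open>l\<close> and one further \<open>j\<close>. The index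
  set \<open>A\<close> is that of the terms of the differential.\<close>

lemma koszul_descend:
  assumes "strongly_bicartesian P r k X" "middle_exact P r k F" "2 \<le> k" "l < k"
    and u: "\<And>j. j < k \<Longrightarrow> u j \<in> carrier (Ob F (X ({..<k} - {j})))"
    and sum: "finsum (Ob F (X {..<k})) (\<lambda>j. Mor F (X ({..<k} - {j})) (X {..<k}) (u j)) {..<k}
      = \<zero>\<^bsub>Ob F (X {..<k})\<^esub>"
  shows "\<exists>(A :: (nat set \<times> nat) set) f. finite A \<and>
    (\<forall>a\<in>A. \<exists>j<k. j \<noteq> l \<and> f a \<in> Mor F (X ({..<k} - {l, j})) (X ({..<k} - {l})) ` carrier (Ob F (X ({..<k} - {l, j})))) \<and>
    u l = finsum (Ob F (X ({..<k} - {l}))) f A"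
proof -
  have XP: "X A \<in> P" if "A \<subseteq> {..<k}" for A
    using assms(1) that by (auto simp: strongly_bicartesian_def cube_def)
  have Xr: "(X A, X B) \<in> r" if "A \<subseteq> B" "B \<subseteq> {..<k}" for A B
    using assms(1) that by (auto simp: strongly_bicartesian_def cube_def)
  \<comment> \<open>The indices of degree \<open>1\<close> are the complements of single points, and
    \<open>the_elem\<close> recovers the missing point.\<close>
  define c where "c = (\<lambda>A\<in>koszul_index k 1. u (the_elem ({..<k} - A)))"
  have idx: "{..<k} - {j} \<in> koszul_index k 1" if "j < k" for j using that by (auto simp: koszul_index_def)
  have el: "{..<k} - ({..<k} - {j}) = {j}" if "j < k" for j :: nat using that by auto
  have idxE: "\<exists>j<k. A = {..<k} - {j}" if "A \<in> koszul_index k 1" for A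
  proof -
    have A: "A \<subseteq> {..<k}" "card A = k - 1" using that by (auto simp: koszul_index_def)
    have "card ({..<k} - A) = 1" using A assms(3) by (simp add: card_Diff_subset finite_subset[OF A(1)])
    then obtain j where "{..<k} - A = {j}" by (auto simp: card_1_singleton_iff)
    then show ?thesis using A(1) by (intro exI[of _ j]) blast
  qed
  have cval: "c ({..<k} - {j}) = u j" if "j < k" for j using idx[OF that] by (simp add: c_def el[OF that])
  have c: "c \<in> carrier (koszul_space F k X 1)"
    unfolding carrier_koszul_space
  proof (rule PiE_I)
    fix A assume "A \<in> koszul_index k 1"
    then obtain j where "j < k" "A = {..<k} - {j}" using idxE by blast
    then show "c A \<in> carrier (Ob F (X A))" using cval u by simp
  qed (simp add: c_def)
  have "koszul_diff F k X 1 c = \<zero>\<^bsub>koszul_space F k X (1 - 1)\<^esub>"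
    unfolding koszul_diff_def zero_koszul_space
  proof (rule restrict_ext)
    fix B assume "B \<in> koszul_index k (1 - 1)"
    then have B: "B = {..<k}" by (simp add: koszul_index_0)
    interpret abelian_monoid "Ob F (X {..<k})" by (rule Ob_abelian_monoid[OF XP[OF order_refl]])
    let ?f = "\<lambda>(A, j). (- 1) ^ j \<odot>\<^bsub>Ob F (X {..<k})\<^esub> Mor F (X A) (X {..<k}) (c A)"
    let ?e = "\<lambda>j. ({..<k} - {j}, 0 :: nat)"
    have set: "{(A, j). A \<in> koszul_index k 1 \<and> j < 1 \<and> {..<k} = A \<union> {sorted_list_of_set ({..<k} - A) ! j}} = ?e ` {..<k}"
      (is "?L = _")
    proof
      show "?L \<subseteq> ?e ` {..<k}" using idxE by auto
      show "?e ` {..<k} \<subseteq> ?L"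
      proof
        fix a assume "a \<in> ?e ` {..<k}"
        then obtain i where i: "i < k" "a = ({..<k} - {i}, 0)" by auto
        then show "a \<in> ?L" using idx[OF i(1)] by (auto simp: el)
      qed
    qed
    have Mc: "Mor F (X ({..<k} - {j})) (X {..<k}) (u j) \<in> carrier (Ob F (X {..<k}))" if "j < k" for j
      using that by (intro Mor_closed Xr u) auto
    have fe: "?f (?e j) = Mor F (X ({..<k} - {j})) (X {..<k}) (u j)" if "j < k" for j
      using Module.module.smult_one[OF Ob_module[OF XP[OF order_refl]] Mc[OF that]] cval[OF that] by simp
    have inj: "inj_on ?e {..<k}" by (auto simp: inj_on_def)
    have "finsum (Ob F (X {..<k})) ?f (?e ` {..<k}) = finsum (Ob F (X {..<k})) (\<lambda>j. ?f (?e j)) {..<k}"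
      by (rule finsum_reindex[OF _ inj]) (use fe Mc in auto)
    also have "\<dots> = finsum (Ob F (X {..<k})) (\<lambda>j. Mor F (X ({..<k} - {j})) (X {..<k}) (u j)) {..<k}"
      by (rule finsum_cong') (use fe Mc in auto)
    also note sum
    finally show "finsum (Ob F (X B)) (\<lambda>(A, j). (- 1) ^ j \<odot>\<^bsub>Ob F (X B)\<^esub> Mor F (X A) (X B) (c A))
      {(A, j). A \<in> koszul_index k 1 \<and> j < 1 \<and> B = A \<union> {sorted_list_of_set ({..<k} - A) ! j}}
      = \<zero>\<^bsub>Ob F (X B)\<^esub>" unfolding B set .
  qed
  moreover have "koszul_homology_trivial F k X 1"
    using assms(1-3) by (simp add: middle_exact_def)
  ultimately have "c \<in> koszul_diff F k X 2 ` carrier (koszul_space F k X 2)"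
    using c unfolding koszul_homology_trivial_def by (auto simp: numeral_2_eq_2)
  then obtain c' where c': "c' \<in> carrier (koszul_space F k X 2)" "c = koszul_diff F k X 2 c'" by blast
  let ?B = "{..<k} - {l}"
  let ?A = "{(A, j). A \<in> koszul_index k 2 \<and> j < 2 \<and> ?B = A \<union> {sorted_list_of_set ({..<k} - A) ! j}}"
  let ?f = "\<lambda>(A, j). (- 1) ^ j \<odot>\<^bsub>Ob F (X ?B)\<^esub> Mor F (X A) (X ?B) (c' A)"
  have "u l = c ?B" using cval[OF assms(4)] by simp
  also have "\<dots> = finsum (Ob F (X ?B)) ?f ?A"
    unfolding c'(2) koszul_diff_def using idx[OF assms(4)] by simp
  finally have ul: "u l = finsum (Ob F (X ?B)) ?f ?A" .
  have "?A \<subseteq> koszul_index k 2 \<times> {..<2}" by auto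
  then have fin: "finite ?A" by (rule finite_subset) (simp add: finite_koszul_index)
  have "\<exists>j<k. j \<noteq> l \<and> ?f a \<in> Mor F (X ({..<k} - {l, j})) (X ?B) ` carrier (Ob F (X ({..<k} - {l, j})))"
    if a: "a \<in> ?A" for a
  proof -
    obtain A i where Ai: "a = (A, i)" "A \<in> koszul_index k 2" "i < 2"
      "?B = A \<union> {sorted_list_of_set ({..<k} - A) ! i}" using a by auto
    let ?t = "sorted_list_of_set ({..<k} - A) ! i"
    obtain t where t_def: "t = ?t" by blast
    have "t \<in> {..<k} - A" unfolding t_def using Ai assms(3) by (intro sorted_nth_in[where i = 2]) (auto simp: koszul_index_def)
    moreover have BA: "?B = A \<union> {t}" using Ai(4) by (simp add: t_def)
    ultimately have t: "t < k" "t \<notin> A" "t \<noteq> l" by auto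
    have A: "A = {..<k} - {l, t}" using BA t(2) by blast
    have cA: "c' A \<in> carrier (Ob F (X A))" using c'(1) Ai(2) by (auto simp: carrier_koszul_space)
    have AP: "X A \<in> P" using Ai(2) by (intro XP) (simp add: koszul_index_def)
    have Ar: "(X A, X ?B) \<in> r" using Ai(4) by (intro Xr) auto
    \<comment> \<open>The sign is absorbed into the argument, so each term is itself an
      image.\<close>
    have "?f a = Mor F (X A) (X ?B) ((- 1) ^ i \<odot>\<^bsub>Ob F (X A)\<^esub> c' A)"
      using Ai(1) Mor_smult[OF Ar cA] by simp
    then have "?f a \<in> Mor F (X A) (X ?B) ` carrier (Ob F (X A))" using Ob_smult[OF AP cA] by blast
    then show ?thesis using t unfolding A by blast
  qed
  then have "\<forall>a\<in>?A. \<exists>j<k. j \<noteq> l \<and>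
      ?f a \<in> Mor F (X ({..<k} - {l, j})) (X ?B) ` carrier (Ob F (X ({..<k} - {l, j})))" by (rule ballI)
  from fin this ul show ?thesis by (intro exI conjI)
qed

end

section \<open>Coordinates\<close>

text \<open>\<open>rank\<close> counts strict predecessors. It is injective with values below
  \<open>card A\<close>, hence onto, and its inverse is the enumeration.\<close>

lemma finite_linear_order_enum:
  assumes fin: "finite A" and lin: "linear_order_on A R"
  shows "\<exists>f. bij_betw f {..<card A} A \<and> (\<forall>i<card A. \<forall>j<card A. (f i, f j) \<in> R \<longleftrightarrow> i \<le> j)"
proof -
  have refl: "(s, s) \<in> R" if "s \<in> A" for s
    using lin that by (auto simp: order_on_defs refl_on_def)
  have trans: "(s, t) \<in> R \<Longrightarrow> (t, u) \<in> R \<Longrightarrow> (s, u) \<in> R" for s t u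
    using lin by (auto simp: order_on_defs dest: transD)
  have anti: "(s, t) \<in> R \<Longrightarrow> (t, s) \<in> R \<Longrightarrow> s = t" for s t
    using lin by (auto simp: order_on_defs dest: antisymD)
  have tot: "(s, t) \<in> R \<or> (t, s) \<in> R" if "s \<in> A" "t \<in> A" for s t
    using lin that refl by (cases "s = t") (auto simp: order_on_defs total_on_def)
  define rank where "rank s = card {t \<in> A. (t, s) \<in> R \<and> t \<noteq> s}" for s
  have rank_less: "rank s < rank t" if "s \<in> A" "t \<in> A" "(s, t) \<in> R" "s \<noteq> t" for s t
    unfolding rank_def
  proof (rule psubset_card_mono)
    have "s \<in> {u \<in> A. (u, t) \<in> R \<and> u \<noteq> t}" using that by simp
    moreover have "{u \<in> A. (u, s) \<in> R \<and> u \<noteq> s} \<subseteq> {u \<in> A. (u, t) \<in> R \<and> u \<noteq> t}"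
      using that trans anti by blast
    ultimately show "{u \<in> A. (u, s) \<in> R \<and> u \<noteq> s} \<subset> {u \<in> A. (u, t) \<in> R \<and> u \<noteq> t}" by blast
  qed (use fin in simp)
  have rank_le: "rank s \<le> rank t \<longleftrightarrow> (s, t) \<in> R" if "s \<in> A" "t \<in> A" for s t
    using rank_less[OF that] rank_less[OF that(2,1)] tot[OF that] refl[OF that(1)]
    by (metis leD less_imp_le order_refl)
  have inj: "inj_on rank A"
  proof (rule inj_onI)
    fix s t assume "s \<in> A" "t \<in> A" "rank s = rank t"
    then show "s = t" using rank_le[of s t] rank_le[of t s] anti by simp
  qed
  have "rank s < card A" if "s \<in> A" for s
    unfolding rank_def using that fin by (intro psubset_card_mono) auto
  then have "rank ` A \<subseteq> {..<card A}" by auto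
  then have "rank ` A = {..<card A}"
    using card_image[OF inj] by (intro card_subset_eq) auto
  then have bij: "bij_betw rank A {..<card A}" using inj by (simp add: bij_betw_def)
  let ?f = "the_inv_into A rank"
  have "bij_betw ?f {..<card A} A" by (rule bij_betw_the_inv_into[OF bij])
  moreover have "(?f i, ?f j) \<in> R \<longleftrightarrow> i \<le> j" if ij: "i < card A" "j < card A" for i j
  proof -
    have "?f i \<in> A" "?f j \<in> A" using \<open>bij_betw ?f {..<card A} A\<close> ij by (auto simp: bij_betw_def)
    moreover have "rank (?f i) = i" "rank (?f j) = j"
      using f_the_inv_into_f_bij_betw[OF bij] ij by auto
    ultimately show ?thesis using rank_le by metis
  qed
  ultimately show ?thesis by blast
qed

lemma prod_coordinates:
  assumes fin: "\<And>i. i < N \<Longrightarrow> finite (S i)"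
    and lin: "\<And>i. i < N \<Longrightarrow> linear_order_on (S i) (R i)"
    and ne: "\<And>i. i < N \<Longrightarrow> S i \<noteq> {}"
  shows "\<exists>h e. finite {i. 0 < h i} \<and> card {i. 0 < h i} \<le> N \<and> bij_betw e {x. x \<le> h} (prod_carrier N S) \<and>
    (\<forall>x\<le>h. \<forall>y\<le>h. (e x, e y) \<in> prod_order N S R \<longleftrightarrow> x \<le> (y :: nat \<Rightarrow> nat))"
proof -
  have "\<forall>i. \<exists>f. i < N \<longrightarrow> bij_betw f {..<card (S i)} (S i) \<and>
      (\<forall>m<card (S i). \<forall>n<card (S i). (f m, f n) \<in> R i \<longleftrightarrow> m \<le> n)"
    using finite_linear_order_enum[OF fin lin] by blast
  then obtain f where f: "\<And>i. i < N \<Longrightarrow> bij_betw (f i) {..<card (S i)} (S i)"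
    and fR: "\<And>i m n. i < N \<Longrightarrow> m < card (S i) \<Longrightarrow> n < card (S i) \<Longrightarrow> (f i m, f i n) \<in> R i \<longleftrightarrow> m \<le> n"
    by metis
  \<comment> \<open>The largest index in factor \<open>i\<close>. It is \<open>0\<close> from
    \<open>N\<close> on, which makes points below \<open>h\<close> vanish there, and also for
    one-element factors, which contribute no direction.\<close>
  define h where "h i = (if i < N then card (S i) - 1 else 0)" for i
  define e where "e x = (\<lambda>i\<in>{..<N}. f i (x i))" for x :: "nat \<Rightarrow> nat"
  have sub: "{i. 0 < h i} \<subseteq> {..<N}" by (auto simp: h_def split: if_splits)
  have pos: "0 < card (S i)" if "i < N" for i using fin[OF that] ne[OF that] by (simp add: card_gt_0_iff)
  have lt: "x i < card (S i)" if "x \<le> h" "i < N" for x i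
    using le_funD[OF that(1), of i] that(2) pos[OF that(2)] by (simp add: h_def)
  have out: "x i = 0" if "x \<le> h" "\<not> i < N" for x i
    using le_funD[OF that(1), of i] that(2) by (simp add: h_def)
  have eP: "e x \<in> prod_carrier N S" if "x \<le> h" for x
    unfolding prod_carrier_def e_def using f lt[OF that] by (auto simp: bij_betw_def)
  have ord: "(e x, e y) \<in> prod_order N S R \<longleftrightarrow> x \<le> y" if x: "x \<le> h" and y: "y \<le> h" for x y
  proof -
    have "(e x, e y) \<in> prod_order N S R \<longleftrightarrow> (\<forall>i<N. (f i (x i), f i (y i)) \<in> R i)"
      using eP[OF x] eP[OF y] by (simp add: prod_order_def e_def)
    also have "\<dots> \<longleftrightarrow> (\<forall>i<N. x i \<le> y i)" using fR lt[OF x] lt[OF y] by simp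
    also have "\<dots> \<longleftrightarrow> x \<le> y" using out[OF x] by (auto simp: le_fun_def) (metis le0)
    finally show ?thesis .
  qed
  have inj: "inj_on e {x. x \<le> h}"
  proof (rule inj_onI, rule ext, goal_cases)
    case (1 x y i)
    then have x: "x \<le> h" and y: "y \<le> h" by auto
    show ?case
    proof (cases "i < N")
      case True
      then have "f i (x i) = f i (y i)" using fun_cong[OF 1(3), of i] by (simp add: e_def)
      then show ?thesis using f[OF True] lt[OF x True] lt[OF y True] by (auto simp: bij_betw_def inj_on_def)
    qed (simp add: out x y)
  qed
  have surj: "p \<in> e ` {x. x \<le> h}" if p: "p \<in> prod_carrier N S" for p
  proof -
    let ?x = "\<lambda>i. if i < N then inv_into {..<card (S i)} (f i) (p i) else 0"
    have pi: "p i \<in> f i ` {..<card (S i)}" if "i < N" for i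
      using f[OF that] p that by (auto simp: bij_betw_def prod_carrier_def)
    have "?x i \<le> h i" for i using inv_into_into[OF pi, of i] by (auto simp: h_def)
    then have "?x \<le> h" by (simp add: le_fun_def)
    moreover have "e ?x i = p i" for i
      using f_inv_into_f[OF pi] p by (auto simp: e_def prod_carrier_def PiE_def extensional_def)
    then have "p = e ?x" by (auto simp: fun_eq_iff)
    ultimately show ?thesis by blast
  qed
  have "bij_betw e {x. x \<le> h} (prod_carrier N S)"
    unfolding bij_betw_def using inj eP surj by blast
  moreover have "card {i. 0 < h i} \<le> N" using card_mono[OF _ sub] by simp
  ultimately show ?thesis using ord finite_subset[OF sub] by blast
qed

lemma mix_bounds:
  fixes p q :: "nat \<Rightarrow> 'a::order"
  assumes "p \<le> q"
  shows "p \<le> mix g p q A" "mix g p q A \<le> q"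
  using assms by (auto simp: mix_def le_fun_def)

text \<open>Bounds are checked coordinatewise. If \<open>g i \<notin> A\<close>, the vertex
  \<open>B - {g i}\<close> has the same \<open>i\<close>-th coordinate as \<open>A\<close>, and it
  differs from \<open>A\<close> because \<open>B - A\<close> has at least two elements; dually,
  \<open>insert (g i) A\<close> serves for \<open>g i \<in> B\<close>.\<close>

lemma mix_strongly_bicartesian:
  fixes h :: "nat \<Rightarrow> nat"
  assumes bij: "bij_betw e {x. x \<le> h} P"
    and ord: "\<And>x y. x \<le> h \<Longrightarrow> y \<le> h \<Longrightarrow> (e x, e y) \<in> r \<longleftrightarrow> x \<le> y"
    and pq: "p \<le> q" "q \<le> h"
  shows "strongly_bicartesian P r k (\<lambda>A. e (mix g p q A))"
proof -
  have mh: "mix g p q A \<le> h" for A using mix_bounds(2)[OF pq(1)] pq(2) by (rule order_trans)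
  have eP: "e x \<in> P" if "x \<le> h" for x using bij that by (auto simp: bij_betw_def)
  have Pe: "\<exists>x\<le>h. w = e x" if "w \<in> P" for w using bij that by (auto simp: bij_betw_def)
  have mono: "(e (mix g p q A), e (mix g p q A')) \<in> r" if "A \<subseteq> A'" for A A'
    using mix_mono[OF pq(1) that] by (simp add: ord mh)
  have cart: "cartesian_face P r (\<lambda>A. e (mix g p q A)) A B"
    and cocart: "cocartesian_face P r (\<lambda>A. e (mix g p q A)) A B"
    if AB: "A \<subseteq> B" "2 \<le> card (B - A)" for A B
  proof -
    have "card (B - A) \<noteq> 0" "card (B - A) \<noteq> 1" using AB(2) by auto
    then have two: "B - A \<noteq> {} \<and> B - A \<noteq> {c}" for c by (metis card.empty card_1_singleton_iff One_nat_def)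
    have "(u, e (mix g p q A)) \<in> r"
      if "u \<in> P" and lb: "\<forall>d\<in>(\<lambda>A. e (mix g p q A)) ` {C. A \<subset> C \<and> C \<subseteq> B}. (u, d) \<in> r" for u
    proof -
      obtain x where x: "x \<le> h" "u = e x" using Pe[OF \<open>u \<in> P\<close>] by blast
      have le: "x \<le> mix g p q C" if "A \<subset> C" "C \<subseteq> B" for C
        using lb that x ord[OF x(1) mh] by blast
      have "x i \<le> mix g p q A i" for i
      proof (cases "g i \<in> A")
        case True
        have "A \<subset> B" using AB two by blast
        from le_funD[OF le[OF this order_refl], of i] True AB(1) show ?thesis by (auto simp: mix_def)
      next
        case False
        have "A \<subset> B - {g i}" using AB(1) False two[of "g i"] by blast
        from le_funD[OF le[OF this], of i] False show ?thesis by (auto simp: mix_def)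
      qed
      then show ?thesis using ord[OF x(1) mh] x by (simp add: le_fun_def)
    qed
    then show "cartesian_face P r (\<lambda>A. e (mix g p q A)) A B"
      unfolding cartesian_face_def is_glb_in_def using eP[OF mh] mono by auto
    have "(e (mix g p q B), u) \<in> r"
      if "u \<in> P" and ub: "\<forall>d\<in>(\<lambda>A. e (mix g p q A)) ` {C. A \<subseteq> C \<and> C \<subset> B}. (d, u) \<in> r" for u
    proof -
      obtain x where x: "x \<le> h" "u = e x" using Pe[OF \<open>u \<in> P\<close>] by blast
      have le: "mix g p q C \<le> x" if "A \<subseteq> C" "C \<subset> B" for C
        using ub that x ord[OF mh x(1)] by blast
      have "mix g p q B i \<le> x i" for i
      proof (cases "g i \<in> B")
        case True
        have "insert (g i) A \<subset> B" using AB(1) True two[of "g i"] by blast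
        from le_funD[OF le[OF _ this], of i] True show ?thesis by (auto simp: mix_def)
      next
        case False
        have "A \<subset> B" using AB two by blast
        moreover have "g i \<notin> A" using False AB(1) by blast
        ultimately show ?thesis using le_funD[OF le[OF order_refl], of i] False by (simp add: mix_def)
      qed
      then show ?thesis using ord[OF mh x(1)] x by (simp add: le_fun_def)
    qed
    then show "cocartesian_face P r (\<lambda>A. e (mix g p q A)) A B"
      unfolding cocartesian_face_def is_lub_in_def using eP[OF mh] mono by auto
  qed
  show ?thesis
    unfolding strongly_bicartesian_def cube_def using eP[OF mh] mono cart cocart by blast
qed

section \<open>Coordinate functions in place of abstract vector spaces\<close>

definition fscale :: "'f::field \<Rightarrow> ('v \<Rightarrow> 'f) \<Rightarrow> 'v \<Rightarrow> 'f" where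
  "fscale c f = (\<lambda>w. c * f w)"

interpretation fun_space: vector_space fscale
  by unfold_locales (auto simp: fscale_def fun_eq_iff algebra_simps)

lemma subspace_supported: "fun_space.subspace {f. \<forall>w. w \<notin> B \<longrightarrow> f w = 0}"
  by (auto simp: fun_space.subspace_def fscale_def)

text \<open>The indicator functions of the points of \<open>B\<close> generate. This supplies the
  finite generating sets for the induction on dimension.\<close>

lemma supported_eq_span:
  assumes "finite B"
  shows "\<exists>C. finite C \<and> fun_space.span C = {f :: 'v \<Rightarrow> 'f::field. \<forall>w. w \<notin> B \<longrightarrow> f w = 0}"
proof -
  define ind where "ind u = (\<lambda>w. if w = u then 1 else 0 :: 'f)" for u :: 'v
  have "f \<in> fun_space.span (ind ` B)" if "\<forall>w. w \<notin> B \<longrightarrow> f w = 0" for f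
    using assms that
  proof (induction B arbitrary: f)
    case empty
    then have "f = 0" by (intro ext) simp
    then show ?case using fun_space.span_zero by blast
  next
    case (insert u B)
    let ?f = "f - fscale (f u) (ind u)"
    have "?f w = 0" if "w \<notin> B" for w
      using insert.prems that by (cases "w = u") (simp_all add: fscale_def ind_def)
    then have "?f \<in> fun_space.span (ind ` B)" by (intro insert.IH allI impI)
    then have "?f \<in> fun_space.span (ind ` insert u B)"
      by (rule subsetD[OF fun_space.span_mono, rotated]) blast
    moreover have "fscale (f u) (ind u) \<in> fun_space.span (ind ` insert u B)"
      by (intro fun_space.span_scale fun_space.span_base) simp
    ultimately have "?f + fscale (f u) (ind u) \<in> fun_space.span (ind ` insert u B)"
      by (rule fun_space.span_add)
    then show ?case by simp
  qed
  moreover have "fun_space.span (ind ` B) \<subseteq> {f. \<forall>w. w \<notin> B \<longrightarrow> f w = 0}"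
    by (rule fun_space.span_minimal[OF _ subspace_supported]) (auto simp: ind_def)
  ultimately show ?thesis using assms by (intro exI[of _ "ind ` B"]) auto
qed

text \<open>As simplification rules these would also eta-expand sums and differences of functions that
  occur as arguments.\<close>

lemmas [simp del] = plus_fun_apply zero_fun_apply minus_apply uminus_apply

lemma (in vector_space) span_UN_subspaces:
  assumes "finite J" "\<And>j. j \<in> J \<Longrightarrow> subspace (U j)" "x \<in> span (\<Union>j\<in>J. U j)"
  shows "\<exists>u. (\<forall>j\<in>J. u j \<in> U j) \<and> x = sum u J"
  using assms
proof (induction J arbitrary: x)
  case (insert j J)
  have "x \<in> span (U j \<union> (\<Union>j\<in>J. U j))" using insert.prems by simp
  then obtain y z where yz: "y \<in> span (U j)" "z \<in> span (\<Union>j\<in>J. U j)" "x = y + z"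
    unfolding span_Un by blast
  obtain u where u: "\<forall>j\<in>J. u j \<in> U j" "z = sum u J" using insert.IH insert.prems(1) yz(2) by blast
  have "y \<in> U j" using yz(1) insert.prems(1) by (simp add: span_eq_iff[THEN iffD2])
  moreover have "sum (u(j := y)) J = sum u J" using insert.hyps(2) by (intro sum.cong) auto
  ultimately show ?case using u yz(3) insert.hyps
    by (intro exI[of _ "u(j := y)"]) auto
qed simp

locale coordinatized = vfunctor_on P r F
  for P :: "'p set" and r and F :: "('p, 'f::field, 'v) vfunctor" +
  fixes h :: "nat \<Rightarrow> nat" and e :: "(nat \<Rightarrow> nat) \<Rightarrow> 'p" and N :: nat
  assumes fin_dir: "finite {i. 0 < h i}"
    and card_dir: "card {i. 0 < h i} \<le> N"
    and e_bij: "bij_betw e {x. x \<le> h} P"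
    and e_order: "\<And>x y. x \<le> h \<Longrightarrow> y \<le> h \<Longrightarrow> (e x, e y) \<in> r \<longleftrightarrow> x \<le> y"
    and r_P: "\<And>x y. (x, y) \<in> r \<Longrightarrow> x \<in> P \<and> y \<in> P"
    and fin_dim: "pointwise_fin_dim P F"
    and middle_exact: "\<And>k. 2 \<le> k \<Longrightarrow> k \<le> N \<Longrightarrow> middle_exact P r k F"
begin

lemma e_P: "x \<le> h \<Longrightarrow> e x \<in> P"
  using e_bij by (auto simp: bij_betw_def)

lemma e_r: "x \<le> y \<Longrightarrow> y \<le> h \<Longrightarrow> (e x, e y) \<in> r"
  using e_order order_trans by blast

definition basis_at :: "'p \<Rightarrow> 'v set" where
  "basis_at p = (SOME \<beta>. finite \<beta> \<and> vectorspace.basis (class_ring :: 'f ring) (Ob F p) \<beta>)"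

text \<open>Coordinates in the chosen basis identify the space at \<open>p\<close> with these
  functions, so that all spaces become subspaces of the one space that \<open>diagram\<close>
  requires; \<open>comb\<close> and \<open>coord\<close> are the two directions of this
  identification.\<close>

definition supported :: "'p \<Rightarrow> ('v \<Rightarrow> 'f) set" where
  "supported p = {f. \<forall>w. w \<notin> basis_at p \<longrightarrow> f w = 0}"

definition comb :: "'p \<Rightarrow> ('v \<Rightarrow> 'f) \<Rightarrow> 'v" where
  "comb p f = LinearCombinations.module.lincomb (Ob F p) f (basis_at p)"

definition coord :: "'p \<Rightarrow> 'v \<Rightarrow> 'v \<Rightarrow> 'f" where
  "coord p u = (THE f. f \<in> supported p \<and> comb p f = u)"

lemma basis_at:
  assumes "p \<in> P"
  shows "finite (basis_at p)" "basis_at p \<subseteq> carrier (Ob F p)"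
    "vectorspace.basis (class_ring :: 'f ring) (Ob F p) (basis_at p)"
proof -
  interpret vectorspace "class_ring :: 'f ring" "Ob F p" by (rule Ob_vectorspace[OF assms])
  have "\<exists>\<beta>. finite \<beta> \<and> basis \<beta>"
    using fin_dim assms by (intro finite_basis_exists) (simp add: pointwise_fin_dim_def)
  then have *: "finite (basis_at p) \<and> basis (basis_at p)" unfolding basis_at_def by (rule someI_ex)
  then show "finite (basis_at p)" "basis (basis_at p)" by auto
  from * show "basis_at p \<subseteq> carrier (Ob F p)" by (simp add: basis_def)
qed

lemma comb_closed: "p \<in> P \<Longrightarrow> comb p f \<in> carrier (Ob F p)"
  unfolding comb_def
  by (rule LinearCombinations.module.lincomb_closed[OF Ob_module]) (auto simp: basis_at)

lemma comb_add:
  assumes "p \<in> P"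
  shows "comb p (f + g) = comb p f \<oplus>\<^bsub>Ob F p\<^esub> comb p g"
  using LinearCombinations.module.lincomb_sum[OF Ob_module[OF assms] basis_at(1,2)[OF assms], of f g]
  by (simp add: comb_def plus_fun_def)

lemma comb_scale:
  assumes "p \<in> P"
  shows "comb p (fscale c f) = c \<odot>\<^bsub>Ob F p\<^esub> comb p f"
  using LinearCombinations.module.lincomb_smult[OF Ob_module[OF assms] basis_at(2)[OF assms], of f c]
  by (simp add: comb_def fscale_def)

text \<open>The basis criterion gives unique coefficients among functions that are extensional on
  the basis; they are carried over to functions extended by \<open>0\<close>, which form a linear
  subspace.\<close>

lemma ex1_coord:
  assumes p: "p \<in> P" and u: "u \<in> carrier (Ob F p)"
  shows "\<exists>!f. f \<in> supported p \<and> comb p f = u"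
proof -
  let ?B = "basis_at p"
  interpret vectorspace "class_ring :: 'f ring" "Ob F p" by (rule Ob_vectorspace[OF p])
  have ex1: "\<exists>!a. a \<in> ?B \<rightarrow>\<^sub>E carrier (class_ring :: 'f ring) \<and> lincomb a ?B = u"
    using basis_criterion[OF basis_at(1,2)[OF p]] basis_at(3)[OF p] u by blast
  have cong: "lincomb f ?B = lincomb g ?B" if "\<And>w. w \<in> ?B \<Longrightarrow> f w = g w" for f g
    by (rule lincomb_cong[OF refl basis_at(2)[OF p] that]) auto
  from ex1 obtain a where a: "lincomb a ?B = u" by blast
  show ?thesis
  proof (rule ex1I[of _ "\<lambda>w. if w \<in> ?B then a w else 0"])
    show "(\<lambda>w. if w \<in> ?B then a w else 0) \<in> supported p \<and> comb p (\<lambda>w. if w \<in> ?B then a w else 0) = u"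
      using cong[of "\<lambda>w. if w \<in> ?B then a w else 0" a] a by (simp add: supported_def comb_def)
  next
    fix f assume f: "f \<in> supported p \<and> comb p f = u"
    have fu: "lincomb (restrict f ?B) ?B = u" using f cong[of "restrict f ?B" f] by (simp add: comb_def)
    have au: "lincomb (restrict a ?B) ?B = u" using a cong[of "restrict a ?B" a] by simp
    have "restrict f ?B = restrict a ?B" using ex1 fu au by (metis (no_types, lifting) UNIV_I partial_object.select_convs(1) restrict_PiE_iff)
    then have "f w = a w" if "w \<in> ?B" for w using that by (metis restrict_apply')
    then show "f = (\<lambda>w. if w \<in> ?B then a w else 0)" using f by (auto simp: supported_def fun_eq_iff)
  qed
qed

lemma coord_supported: "p \<in> P \<Longrightarrow> u \<in> carrier (Ob F p) \<Longrightarrow> coord p u \<in> supported p"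
  and comb_coord: "p \<in> P \<Longrightarrow> u \<in> carrier (Ob F p) \<Longrightarrow> comb p (coord p u) = u"
  using theI'[OF ex1_coord] unfolding coord_def by blast+

lemma coord_eqI: "p \<in> P \<Longrightarrow> f \<in> supported p \<Longrightarrow> comb p f = u \<Longrightarrow> coord p u = f"
  using ex1_coord[of p u] comb_closed[of p f] coord_supported[of p u] comb_coord[of p u] by blast

lemma supported_subspace: "fun_space.subspace (supported p)"
  unfolding supported_def by (rule subspace_supported)

lemma coord_add:
  assumes "p \<in> P" "u \<in> carrier (Ob F p)" "v \<in> carrier (Ob F p)"
  shows "coord p (u \<oplus>\<^bsub>Ob F p\<^esub> v) = coord p u + coord p v"
  using assms coord_supported comb_coord
  by (intro coord_eqI fun_space.subspace_add[OF supported_subspace]) (auto simp: comb_add)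

lemma coord_smult:
  assumes "p \<in> P" "u \<in> carrier (Ob F p)"
  shows "coord p (c \<odot>\<^bsub>Ob F p\<^esub> u) = fscale c (coord p u)"
  using assms coord_supported comb_coord
  by (intro coord_eqI fun_space.subspace_scale[OF supported_subspace]) (auto simp: comb_scale)

lemma comb_zero: "p \<in> P \<Longrightarrow> comb p 0 = \<zero>\<^bsub>Ob F p\<^esub>"
  using comb_scale[of p 0 0] Module.module.smult_l_null[OF Ob_module, of p "comb p 0"] comb_closed[of p 0]
  by (simp add: fscale_def zero_fun_def)

lemma coord_zero: "p \<in> P \<Longrightarrow> coord p \<zero>\<^bsub>Ob F p\<^esub> = 0"
  using fun_space.subspace_0[OF supported_subspace] comb_zero by (intro coord_eqI)

lemma comb_sum:
  assumes p: "p \<in> P" and "finite J"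
  shows "comb p (sum f J) = finsum (Ob F p) (\<lambda>j. comb p (f j)) J"
proof -
  interpret abelian_monoid "Ob F p" by (rule Ob_abelian_monoid[OF p])
  show ?thesis using assms(2)
  proof (induction J)
    case (insert j J)
    then show ?case using comb_closed[OF p] by (simp add: comb_add[OF p])
  qed (simp add: comb_zero[OF p])
qed

lemma coord_finsum_in_subspace:
  assumes p: "p \<in> P" and U: "fun_space.subspace U" and "finite A"
    and "\<And>a. a \<in> A \<Longrightarrow> f a \<in> carrier (Ob F p) \<and> coord p (f a) \<in> U"
  shows "coord p (finsum (Ob F p) f A) \<in> U"
proof -
  interpret abelian_monoid "Ob F p" by (rule Ob_abelian_monoid[OF p])
  show ?thesis using assms(3,4)
  proof (induction A)
    case empty
    then show ?case using coord_zero[OF p] fun_space.subspace_0[OF U] by simp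
  next
    case (insert a A)
    have "finsum (Ob F p) f (insert a A) = f a \<oplus>\<^bsub>Ob F p\<^esub> finsum (Ob F p) f A"
      using insert by (intro finsum_insert) auto
    moreover have "finsum (Ob F p) f A \<in> carrier (Ob F p)" using insert by (intro finsum_closed) auto
    ultimately show ?case using insert coord_add[OF p] fun_space.subspace_add[OF U] by simp
  qed
qed

text \<open>The map of \<open>F\<close> in coordinates. It is linear on all functions, not only on
  supported ones, because \<open>comb\<close> reads only the values on the basis.\<close>

definition T :: "(nat \<Rightarrow> nat) \<Rightarrow> (nat \<Rightarrow> nat) \<Rightarrow> ('v \<Rightarrow> 'f) \<Rightarrow> 'v \<Rightarrow> 'f" where
  "T x y f = coord (e y) (Mor F (e x) (e y) (comb (e x) f))"

lemma Mor_comb: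
  assumes "x \<le> y" "y \<le> h"
  shows "Mor F (e x) (e y) (comb (e x) f) \<in> carrier (Ob F (e y))"
  using assms order_trans by (intro Mor_closed e_r comb_closed e_P) auto

lemma comb_T: "x \<le> y \<Longrightarrow> y \<le> h \<Longrightarrow> comb (e y) (T x y f) = Mor F (e x) (e y) (comb (e x) f)"
  unfolding T_def by (intro comb_coord e_P Mor_comb)

lemma T_supported: "x \<le> y \<Longrightarrow> y \<le> h \<Longrightarrow> T x y f \<in> supported (e y)"
  unfolding T_def by (intro coord_supported e_P Mor_comb)

lemma T_coord:
  assumes "x \<le> y" "y \<le> h" "u \<in> carrier (Ob F (e x))"
  shows "T x y (coord (e x) u) = coord (e y) (Mor F (e x) (e y) u)"
  using assms by (simp add: T_def comb_coord e_P order_trans)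

lemma coord_comb: "x \<le> h \<Longrightarrow> f \<in> supported (e x) \<Longrightarrow> coord (e x) (comb (e x) f) = f"
  by (rule coord_eqI[OF e_P]) auto

lemma T_linear:
  assumes "x \<le> y" "y \<le> h"
  shows "Vector_Spaces.linear fscale fscale (T x y)"
proof -
  have x: "x \<le> h" using assms by (rule order_trans)
  have "T x y (f + g) = T x y f + T x y g" for f g
    using Mor_comb[OF assms]
    by (simp add: T_def comb_add e_P x Mor_add[OF e_r[OF assms]] comb_closed coord_add assms(2))
  moreover have "T x y (fscale c f) = fscale c (T x y f)" for c f
    using Mor_comb[OF assms]
    by (simp add: T_def comb_scale e_P x Mor_smult[OF e_r[OF assms]] comb_closed coord_smult assms(2))
  ultimately show ?thesis
    unfolding Vector_Spaces.linear_iff using fun_space.vector_space_axioms by blast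
qed

lemma lift_lessThan:
  assumes pq: "p \<le> q" "q \<le> h" and k: "2 \<le> k" "k \<le> N" "l < k"
    and v: "v \<in> supported (e (mix g p q {l}))"
    and kill: "\<And>j. j < k \<Longrightarrow> j \<noteq> l \<Longrightarrow> T (mix g p q {l}) (mix g p q {l, j}) v = 0"
  shows "\<exists>w\<in>supported (e p). T p (mix g p q {l}) w = v \<and> (\<forall>j<k. j \<noteq> l \<longrightarrow> T p (mix g p q {j}) w = 0)"
proof -
  let ?X = "\<lambda>A. e (mix g p q A)"
  have mh: "mix g p q A \<le> h" for A using mix_bounds(2)[OF pq(1)] pq(2) by (rule order_trans)
  have mm: "mix g p q A \<le> mix g p q A'" if "A \<subseteq> A'" for A A' by (rule mix_mono[OF pq(1) that])
  have p0: "mix g p q {} = p" by (simp add: mix_def)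
  have "\<exists>w\<in>carrier (Ob F (?X {})). Mor F (?X {}) (?X {l}) w = comb (?X {l}) v \<and>
      (\<forall>j<k. j \<noteq> l \<longrightarrow> Mor F (?X {}) (?X {j}) w = \<zero>\<^bsub>Ob F (?X {j})\<^esub>)"
  proof (rule koszul_lift[OF _ middle_exact[OF k(1,2)] k(1,3)])
    show "strongly_bicartesian P r k ?X" by (rule mix_strongly_bicartesian[OF e_bij e_order pq])
    show "comb (?X {l}) v \<in> carrier (Ob F (?X {l}))" by (intro comb_closed e_P mh)
    fix j assume "j < k" "j \<noteq> l"
    then show "Mor F (?X {l}) (?X {l, j}) (comb (?X {l}) v) = \<zero>\<^bsub>Ob F (?X {l, j})\<^esub>"
      using comb_T[OF mm mh, of "{l}" "{l, j}" v] kill comb_zero[OF e_P[OF mh]] by simp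
  qed
  then obtain w where w: "w \<in> carrier (Ob F (e p))" "Mor F (e p) (?X {l}) w = comb (?X {l}) v"
    "\<And>j. j < k \<Longrightarrow> j \<noteq> l \<Longrightarrow> Mor F (e p) (?X {j}) w = \<zero>\<^bsub>Ob F (?X {j})\<^esub>"
    unfolding p0 by blast
  have pm: "p \<le> mix g p q A" for A by (rule mix_bounds(1)[OF pq(1)])
  have ph: "p \<le> h" using pq by (rule order_trans)
  show ?thesis
    using w T_coord[OF pm mh w(1)] coord_supported[OF e_P[OF ph] w(1)] coord_comb[OF mh v] coord_zero[OF e_P[OF mh]]
    by (intro bexI[of _ "coord (e p) w"]) auto
qed

lemma descend_lessThan:
  assumes pq: "p \<le> q" "q \<le> h" and k: "2 \<le> k" "k \<le> N" "l < k"
    and v: "v \<in> supported (e (mix g p q ({..<k} - {l})))"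
    and sp: "T (mix g p q ({..<k} - {l})) (mix g p q {..<k}) v \<in>
      fun_space.span (\<Union>j\<in>{..<k} - {l}. T (mix g p q ({..<k} - {j})) (mix g p q {..<k}) ` supported (e (mix g p q ({..<k} - {j}))))"
  shows "v \<in> fun_space.span (\<Union>j\<in>{..<k} - {l}.
      T (mix g p q ({..<k} - {l, j})) (mix g p q ({..<k} - {l})) ` supported (e (mix g p q ({..<k} - {l, j}))))"
proof -
  let ?m = "mix g p q"
  let ?X = "\<lambda>A. e (?m A)"
  let ?K = "{..<k}"
  interpret fs: vector_space_pair fscale fscale ..
  have mh: "?m A \<le> h" for A using mix_bounds(2)[OF pq(1)] pq(2) by (rule order_trans)
  have mm: "?m A \<le> ?m A'" if "A \<subseteq> A'" for A A' by (rule mix_mono[OF pq(1) that])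
  have sub: "fun_space.subspace (T (?m (?K - {j})) (?m ?K) ` supported (?X (?K - {j})))" for j
    by (intro fs.linear_subspace_image T_linear mm mh supported_subspace) auto
  obtain u where u: "\<forall>j\<in>?K - {l}. u j \<in> T (?m (?K - {j})) (?m ?K) ` supported (?X (?K - {j}))"
    "T (?m (?K - {l})) (?m ?K) v = sum u (?K - {l})"
    using fun_space.span_UN_subspaces[OF _ sub sp] by auto
  then have "\<forall>j\<in>?K - {l}. \<exists>y. u j = T (?m (?K - {j})) (?m ?K) y" by blast
  then obtain y where y: "\<And>j. j \<in> ?K - {l} \<Longrightarrow> u j = T (?m (?K - {j})) (?m ?K) (y j)" by metis
  \<comment> \<open>The signs turn the equation between the image of \<open>v\<close> and a sum of
    other images into a vanishing sum, that is, into a cycle of degree \<open>1\<close>.\<close>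
  define z where "z j = (if j = l then v else - y j)" for j
  let ?t = "\<lambda>j. T (?m (?K - {j})) (?m ?K) (z j)"
  have tl: "T (?m (?K - {j})) (?m ?K) (- f) = - T (?m (?K - {j})) (?m ?K) f" for j f
    by (rule fs.linear_neg[OF T_linear]) (auto intro: mm mh)
  have "sum ?t ?K = ?t l + sum ?t (?K - {l})" using k(3) by (intro sum.remove) auto
  also have "sum ?t (?K - {l}) = sum (\<lambda>j. - u j) (?K - {l})"
    using y by (intro sum.cong) (auto simp: z_def tl)
  also have "?t l = sum u (?K - {l})" using u(2) by (simp add: z_def)
  finally have t0: "sum ?t ?K = 0" by (simp add: sum_negf)
  have MP: "Mor F (?X (?K - {j})) (?X ?K) (comb (?X (?K - {j})) (z j)) = comb (?X ?K) (?t j)" for j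
    by (rule comb_T[symmetric]) (auto intro: mm mh)
  have "\<exists>(A :: (nat set \<times> nat) set) f. finite A \<and>
      (\<forall>a\<in>A. \<exists>j<k. j \<noteq> l \<and> f a \<in> Mor F (?X (?K - {l, j})) (?X (?K - {l})) ` carrier (Ob F (?X (?K - {l, j})))) \<and>
      comb (?X (?K - {l})) (z l) = finsum (Ob F (?X (?K - {l}))) f A"
  proof (rule koszul_descend[OF _ middle_exact[OF k(1,2)] k(1,3)])
    show "strongly_bicartesian P r k ?X" by (rule mix_strongly_bicartesian[OF e_bij e_order pq])
    show "comb (?X (?K - {j})) (z j) \<in> carrier (Ob F (?X (?K - {j})))" for j
      by (intro comb_closed e_P mh)
    show "finsum (Ob F (?X ?K)) (\<lambda>j. Mor F (?X (?K - {j})) (?X ?K) (comb (?X (?K - {j})) (z j))) ?K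
      = \<zero>\<^bsub>Ob F (?X ?K)\<^esub>"
      unfolding MP using comb_sum[OF e_P[OF mh], where J = ?K and f = ?t] t0 comb_zero[OF e_P[OF mh]] by simp
  qed
  then obtain A :: "(nat set \<times> nat) set" and f where A: "finite A"
    "\<forall>a\<in>A. \<exists>j<k. j \<noteq> l \<and> f a \<in> Mor F (?X (?K - {l, j})) (?X (?K - {l})) ` carrier (Ob F (?X (?K - {l, j})))"
    "comb (?X (?K - {l})) (z l) = finsum (Ob F (?X (?K - {l}))) f A"
    by (elim exE conjE)
  let ?V = "\<Union>j\<in>?K - {l}. T (?m (?K - {l, j})) (?m (?K - {l})) ` supported (?X (?K - {l, j}))"
  have "coord (?X (?K - {l})) (finsum (Ob F (?X (?K - {l}))) f A) \<in> fun_space.span ?V"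
  proof (rule coord_finsum_in_subspace[OF e_P[OF mh] fun_space.subspace_span A(1)])
    fix a assume "a \<in> A"
    then obtain j w where j: "j < k" "j \<noteq> l" and w: "w \<in> carrier (Ob F (?X (?K - {l, j})))"
      and fa: "f a = Mor F (?X (?K - {l, j})) (?X (?K - {l})) w" using A(2) by blast
    have le: "?m (?K - {l, j}) \<le> ?m (?K - {l})" by (rule mm) auto
    have "coord (?X (?K - {l})) (f a) = T (?m (?K - {l, j})) (?m (?K - {l})) (coord (?X (?K - {l, j})) w)"
      unfolding fa by (rule T_coord[OF le mh w, symmetric])
    moreover have "coord (?X (?K - {l, j})) w \<in> supported (?X (?K - {l, j}))"
      by (rule coord_supported[OF e_P[OF mh] w])
    ultimately have "coord (?X (?K - {l})) (f a) \<in> ?V" using j by (intro UN_I[of j]) auto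
    then show "f a \<in> carrier (Ob F (?X (?K - {l}))) \<and> coord (?X (?K - {l})) (f a) \<in> fun_space.span ?V"
      using Mor_closed[OF e_r[OF le mh] w] by (simp only: fa fun_space.span_base)
  qed
  then show ?thesis using A(3) coord_comb[OF mh v] by (simp add: z_def)
qed

lemma relabel:
  fixes g :: "nat \<Rightarrow> nat"
  assumes "finite L" "l \<in> L"
  shows "\<exists>\<beta>. bij_betw \<beta> L {..<card L} \<and>
    (\<forall>p q :: nat \<Rightarrow> nat. \<forall>A. A \<subseteq> L \<longrightarrow> mix (\<lambda>i. if g i \<in> L then \<beta> (g i) else card L) p q (\<beta> ` A) = mix g p q A)"
proof -
  obtain \<beta> where \<beta>: "bij_betw \<beta> L {..<card L}" using ex_bij_betw_finite_nat[OF assms(1)] by (auto simp: lessThan_atLeast0)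
  have inj: "inj_on \<beta> L" and im: "\<beta> ` L = {..<card L}" using \<beta> by (auto simp: bij_betw_def)
  have "(if g i \<in> L then \<beta> (g i) else card L) \<in> \<beta> ` A \<longleftrightarrow> g i \<in> A" if A: "A \<subseteq> L" for i A
  proof (cases "g i \<in> L")
    case True
    then show ?thesis using inj_on_image_mem_iff[OF inj True A] by simp
  next
    case False
    have "card L \<notin> \<beta> ` A" using im A by auto
    then show ?thesis using False A by auto
  qed
  then have "mix (\<lambda>i. if g i \<in> L then \<beta> (g i) else card L) p q (\<beta> ` A) = mix g p q A" if "A \<subseteq> L" for p q :: "nat \<Rightarrow> nat" and A
    using that unfolding mix_def by (intro ext if_cong) auto
  with \<beta> show ?thesis by (intro exI[of _ \<beta>] conjI allI impI)
qed

lemma diagram_T: "diagram fscale h N T (\<lambda>x. supported (e x))"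
proof (intro diagram.intro diagram_axioms.intro fun_space.vector_space_axioms, goal_cases)
  case 1 show ?case by (rule fin_dir)
next
  case 2 show ?case by (rule card_dir)
next
  case (3 x y) then show ?case by (rule T_linear)
next
  case (4 x) show ?case by (rule supported_subspace)
next
  case (5 x y v) then show ?case by (intro T_supported)
next
  case (6 x v) then show ?case by (simp add: T_def Mor_id e_P comb_closed coord_comb)
next
  case (7 x y z v)
  have "y \<le> h" "x \<le> h" using 7 order_trans by blast+
  then show ?case
    using Mor_trans[OF e_r[OF 7(1)] e_r[OF 7(2,3)] comb_closed[OF e_P]] comb_T[OF 7(1), of v]
    by (simp add: T_def)
next
  case (8 p q L l v g)
  from relabel[OF 8(3,6), where g = g] obtain \<beta> where \<beta>: "bij_betw \<beta> L {..<card L}"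
    and mix_all: "\<forall>p q :: nat \<Rightarrow> nat. \<forall>A. A \<subseteq> L \<longrightarrow>
      mix (\<lambda>i. if g i \<in> L then \<beta> (g i) else card L) p q (\<beta> ` A) = mix g p q A"
    by (elim exE conjE)
  have mix: "mix (\<lambda>i. if g i \<in> L then \<beta> (g i) else card L) p q (\<beta> ` A) = mix g p q A" if "A \<subseteq> L" for A
    using mix_all that by simp
  let ?g = "\<lambda>i. if g i \<in> L then \<beta> (g i) else card L"
  have inj: "inj_on \<beta> L" and im: "\<beta> ` L = {..<card L}" using \<beta> by (auto simp: bij_betw_def)
  have m1: "mix ?g p q {\<beta> j} = mix g p q {j}" if "j \<in> L" for j using mix[of "{j}"] that by simp
  have m2: "mix ?g p q {\<beta> l, \<beta> j} = mix g p q {l, j}" if "j \<in> L" for j using mix[of "{l, j}"] that 8(6) by simp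
  have \<beta>l: "\<beta> l < card L" using im 8(6) by auto
  have kill: "T (mix ?g p q {\<beta> l}) (mix ?g p q {\<beta> l, i}) v = 0" if "i < card L" "i \<noteq> \<beta> l" for i
  proof -
    obtain j where j: "j \<in> L" "i = \<beta> j" using \<open>i < card L\<close> im by auto
    then have "j \<noteq> l" using that by auto
    then show ?thesis using 8(8)[of j] j by (simp only: m1[OF 8(6)] m2[OF j(1)] j(2)) simp
  qed
  have v: "v \<in> supported (e (mix ?g p q {\<beta> l}))" using 8(7) by (simp only: m1[OF 8(6)])
  obtain w where w: "w \<in> supported (e p)" "T p (mix ?g p q {\<beta> l}) w = v"
    and wk: "\<And>i. i < card L \<Longrightarrow> i \<noteq> \<beta> l \<Longrightarrow> T p (mix ?g p q {i}) w = 0"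
    using lift_lessThan[OF 8(1,2,4,5) \<beta>l v kill] by blast
  have wk': "T p (mix g p q {j}) w = 0" if j: "j \<in> L - {l}" for j
  proof -
    have "\<beta> j < card L" "\<beta> j \<noteq> \<beta> l" using j im 8(6) inj by (auto simp: inj_on_def)
    from wk[OF this] show ?thesis using m1[of j] j by simp
  qed
  show ?case
  proof (intro bexI[of _ w] conjI ballI)
    show "w \<in> supported (e p)" by (rule w(1))
    show "T p (mix g p q {l}) w = v" using w(2) by (simp only: m1[OF 8(6)])
    show "T p (mix g p q {j}) w = 0" if "j \<in> L - {l}" for j by (rule wk'[OF that])
  qed
next
  case (9 p q L l v g)
  from relabel[OF 9(3,6), where g = g] obtain \<beta> where \<beta>: "bij_betw \<beta> L {..<card L}"
    and mix_all: "\<forall>p q :: nat \<Rightarrow> nat. \<forall>A. A \<subseteq> L \<longrightarrow>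
      mix (\<lambda>i. if g i \<in> L then \<beta> (g i) else card L) p q (\<beta> ` A) = mix g p q A"
    by (elim exE conjE)
  have mix: "mix (\<lambda>i. if g i \<in> L then \<beta> (g i) else card L) p q (\<beta> ` A) = mix g p q A" if "A \<subseteq> L" for A
    using mix_all that by simp
  let ?g = "\<lambda>i. if g i \<in> L then \<beta> (g i) else card L"
  have inj: "inj_on \<beta> L" and im: "\<beta> ` L = {..<card L}" using \<beta> by (auto simp: bij_betw_def)
  have \<beta>l: "\<beta> l < card L" using im 9(6) by auto
  have D1: "{..<card L} - {\<beta> j} = \<beta> ` (L - {j})" if "j \<in> L" for j
    using inj_on_image_set_diff[OF inj, of L "{j}"] that im by simp
  have D2: "{..<card L} - {\<beta> l, \<beta> j} = \<beta> ` (L - {l, j})" if "j \<in> L" for j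
    using inj_on_image_set_diff[OF inj, of L "{l, j}"] that 9(6) im by simp
  have m0: "mix ?g p q {..<card L} = mix g p q L" using mix[of L] im by simp
  have m1: "mix ?g p q ({..<card L} - {\<beta> j}) = mix g p q (L - {j})" if "j \<in> L" for j
    unfolding D1[OF that] by (rule mix) auto
  have m2: "mix ?g p q ({..<card L} - {\<beta> l, \<beta> j}) = mix g p q (L - {l, j})" if "j \<in> L" for j
    unfolding D2[OF that] by (rule mix) auto
  have U: "(\<Union>i\<in>{..<card L} - {\<beta> l}. H i) = (\<Union>j\<in>L - {l}. H (\<beta> j))" for H :: "nat \<Rightarrow> ('v \<Rightarrow> 'f) set"
    unfolding D1[OF 9(6)] by auto
  have U1: "(\<Union>i\<in>{..<card L} - {\<beta> l}. T (mix ?g p q ({..<card L} - {i})) (mix g p q L) `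
      supported (e (mix ?g p q ({..<card L} - {i})))) =
    (\<Union>j\<in>L - {l}. T (mix g p q (L - {j})) (mix g p q L) ` supported (e (mix g p q (L - {j}))))"
    unfolding U by (rule SUP_cong[OF refl]) (simp only: m1 Diff_iff)
  have U2: "(\<Union>i\<in>{..<card L} - {\<beta> l}. T (mix ?g p q ({..<card L} - {\<beta> l, i})) (mix g p q (L - {l})) `
      supported (e (mix ?g p q ({..<card L} - {\<beta> l, i})))) =
    (\<Union>j\<in>L - {l}. T (mix g p q (L - {l, j})) (mix g p q (L - {l})) ` supported (e (mix g p q (L - {l, j}))))"
    unfolding U by (rule SUP_cong[OF refl]) (simp only: m2 Diff_iff)
  show ?case
    using descend_lessThan[OF 9(1,2,4,5) \<beta>l, of v ?g] 9(7,8)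
    unfolding m0 m1[OF 9(6)] U1 U2 by blast
qed

end

section \<open>Interval decomposition\<close>

lemma vectorspace_interval_sum:
  fixes I :: "nat \<Rightarrow> 'p set"
  assumes "field (class_ring :: 'f::field ring)"
  shows "vectorspace (class_ring :: 'f ring)
    (Ob (vfunctor_sum {..<M} (\<lambda>m. interval_module (I m) :: ('p, 'f, 'f) vfunctor)) p)"
proof (rule vs_criteria[OF assms], goal_cases)
  case 3
  show ?case
  proof
    fix c assume c: "c \<in> carrier (Ob (vfunctor_sum {..<M} (\<lambda>m. interval_module (I m) :: ('p, 'f, 'f) vfunctor)) p)"
    have c0: "c m = 0" if "m < M" "p \<notin> I m" for m
      using c that by (auto simp: vfunctor_sum_def module_sum_def interval_module_def PiE_iff dest!: bspec[of _ _ m])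
    show "\<exists>n\<in>carrier (Ob (vfunctor_sum {..<M} (\<lambda>m. interval_module (I m))) p).
      c \<oplus>\<^bsub>Ob (vfunctor_sum {..<M} (\<lambda>m. interval_module (I m))) p\<^esub> n = \<zero>\<^bsub>Ob (vfunctor_sum {..<M} (\<lambda>m. interval_module (I m))) p\<^esub>"
      by (rule bexI[of _ "\<lambda>m\<in>{..<M}. - c m"])
        (use c c0 in \<open>auto simp: vfunctor_sum_def module_sum_def interval_module_def PiE_iff extensional_def fun_eq_iff\<close>)
  qed
qed (auto simp: vfunctor_sum_def module_sum_def interval_module_def PiE_iff extensional_def fun_eq_iff algebra_simps)

context coordinatized
begin

lemma box_interval:
  assumes "a \<le> b" "b \<le> h"
  shows "poset_interval P r (e ` {a..b})"
  unfolding poset_interval_def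
proof (intro conjI ballI impI)
  have le: "x \<le> h" if "x \<in> {a..b}" for x using that assms(2) order_trans by auto
  show "e ` {a..b} \<subseteq> P" using e_P le by blast
  fix x y assume "x \<in> e ` {a..b}" "y \<in> e ` {a..b}"
  then obtain x' y' where x: "x = e x'" "x' \<in> {a..b}" and y: "y = e y'" "y' \<in> {a..b}" by blast
  show "z \<in> e ` {a..b}" if "z \<in> P" "(x, z) \<in> r \<and> (z, y) \<in> r" for z
  proof -
    obtain z' where z: "z = e z'" "z' \<le> h" using e_bij \<open>z \<in> P\<close> by (auto simp: bij_betw_def)
    have "x' \<le> z'" "z' \<le> y'" using that(2) e_order le x y z by auto
    then have "z' \<in> {a..b}" using x(2) y(2) by (auto intro: order_trans)
    then show ?thesis using z(1) by blast
  qed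
  \<comment> \<open>The zigzag \<open>x \<le> e b \<ge> e a \<le> y\<close> runs through both
    corners of the box.\<close>
  let ?u = "\<lambda>m :: nat. if m = 0 then x else e a"
  let ?v = "\<lambda>m :: nat. if m = 0 then e b else y"
  have ab: "a \<in> {a..b}" "b \<in> {a..b}" using assms(1) by auto
  have r: "(e s, e t) \<in> r" if "s \<in> {a..b}" "t \<in> {a..b}" "s \<le> t" for s t
    using e_order[OF le[OF that(1)] le[OF that(2)]] that(3) by simp
  have "(x, e b) \<in> r" "(e a, y) \<in> r" "(e a, e b) \<in> r"
    using r x y ab assms(1) by auto
  then have "?u 0 = x \<and> ?v 1 = y \<and> (\<forall>m\<le>1. ?u m \<in> e ` {a..b} \<and> ?v m \<in> e ` {a..b} \<and> (?u m, ?v m) \<in> r) \<and>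
    (\<forall>m<1. (?u (Suc m), ?v m) \<in> r)"
    using x y ab by auto
  then show "\<exists>n u v. u 0 = x \<and> v n = y \<and> (\<forall>m\<le>n. u m \<in> e ` {a..b} \<and> v m \<in> e ` {a..b} \<and> (u m, v m) \<in> r) \<and>
    (\<forall>m<n. (u (Suc m), v m) \<in> r)"
    by (intro exI[of _ "1 :: nat"] exI[of _ ?u] exI[of _ ?v])
qed

theorem interval_decomposable: "interval_decomposable P r F"
proof -
  interpret sc: vector_space_pair fscale "(*) :: 'f \<Rightarrow> 'f \<Rightarrow> 'f"
    by (rule fun_space.vector_space_pair_scalars)
  have "\<exists>B. finite B \<and> fun_space.span B = supported (e x)" if "x \<le> h" for x
    unfolding supported_def by (rule supported_eq_span[OF basis_at(1)[OF e_P[OF that]]])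
  from fun_space.ex_box_basis[OF diagram_T this]
  obtain M I \<kappa> where box: "box_basis fscale h T (\<lambda>x. supported (e x)) M I \<kappa>" by blast
  have boxes: "\<exists>a b. a \<le> b \<and> b \<le> h \<and> I m = {a..b}" if "m < M" for m
    using box that unfolding box_basis_def by simp
  have lin: "Vector_Spaces.linear fscale (*) (\<kappa> m x)" if "m < M" "x \<le> h" for m x
    using box that unfolding box_basis_def by simp
  have nat: "\<kappa> m y (T x y w) = (if x \<in> I m \<and> y \<in> I m then \<kappa> m x w else 0)"
    if "m < M" "x \<le> y" "y \<le> h" "w \<in> supported (e x)" for m x y w
    using box that unfolding box_basis_def by simp
  have bij: "\<exists>!w. w \<in> supported (e x) \<and> (\<forall>m<M. \<kappa> m x w = c m)"
    if "x \<le> h" "\<And>m. m < M \<Longrightarrow> x \<notin> I m \<Longrightarrow> c m = 0" for x c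
    using box that unfolding box_basis_def by simp
  \<comment> \<open>Naturality for the identity map at \<open>x\<close>: outside the box its
    right-hand side is \<open>0\<close>.\<close>
  have vanish: "\<kappa> m x w = 0" if "m < M" "x \<le> h" "w \<in> supported (e x)" "x \<notin> I m" for m x w
  proof -
    interpret D: diagram fscale h N T "\<lambda>x. supported (e x)" by (rule diagram_T)
    show ?thesis using nat[OF that(1) order_refl that(2,3)] D.T_id[OF that(2,3)] that(4) by simp
  qed
  have Ih: "x \<le> h" if "m < M" "x \<in> I m" for m x
    using boxes[OF that(1)] that(2) order_trans by auto
  have inj: "e x = e y \<longleftrightarrow> x = y" if "x \<le> h" "y \<le> h" for x y
    using e_bij that by (auto simp: bij_betw_def inj_on_def)
  have mem: "e x \<in> e ` I m \<longleftrightarrow> x \<in> I m" if "m < M" "x \<le> h" for m x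
    using inj[OF that(2)] Ih[OF that(1)] by blast
  let ?G = "vfunctor_sum {..<M} (\<lambda>m. interval_module (e ` I m) :: ('p, 'f, 'f) vfunctor)"
  have carG: "carrier (Ob ?G (e x)) = {c \<in> extensional {..<M}. \<forall>m<M. x \<notin> I m \<longrightarrow> c m = 0}" if "x \<le> h" for x
    using mem[OF _ that]
    by (auto simp: vfunctor_sum_def module_sum_def interval_module_def PiE_iff split: if_splits)
  define \<eta> where "\<eta> p u = (\<lambda>m\<in>{..<M}. \<kappa> m (inv_into {x. x \<le> h} e p) (coord p u))" for p u
  have \<eta>: "\<eta> (e x) u = (\<lambda>m\<in>{..<M}. \<kappa> m x (coord (e x) u))" if "x \<le> h" for x u
    using e_bij that by (simp add: \<eta>_def bij_betw_def inv_into_f_f)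
  have \<eta>_closed: "\<eta> (e x) u \<in> carrier (Ob ?G (e x))" if "x \<le> h" "u \<in> carrier (Ob F (e x))" for x u
    unfolding carG[OF that(1)] \<eta>[OF that(1)]
    using vanish[OF _ that(1) coord_supported[OF e_P[OF that(1)] that(2)]] by simp
  have linear: "linear_map (class_ring :: 'f ring) (Ob F (e x)) (Ob ?G (e x)) (\<eta> (e x))" if x: "x \<le> h" for x
  proof -
    have vF: "vectorspace (class_ring :: 'f ring) (Ob F (e x))" by (rule Ob_vectorspace[OF e_P[OF x]])
    then have vG: "vectorspace (class_ring :: 'f ring) (Ob ?G (e x))"
      by (intro vectorspace_interval_sum) (rule vectorspace.axioms(2))
    have "\<eta> (e x) \<in> LinearCombinations.module_hom (class_ring :: 'f ring) (Ob F (e x)) (Ob ?G (e x))"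
      unfolding LinearCombinations.module_hom_def
    proof (intro CollectI conjI allI impI, goal_cases)
      case 1
      show ?case using \<eta>_closed[OF x] by blast
    next
      case (2 u v)
      then show ?case
        using coord_add[OF e_P[OF x], of u v] sc.linear_add[OF lin[OF _ x]]
        by (auto simp: \<eta>[OF x] vfunctor_sum_def module_sum_def interval_module_def)
    next
      case (3 c u)
      then show ?case
        using coord_smult[OF e_P[OF x], of u c] sc.linear_scale[OF lin[OF _ x]]
        by (auto simp: \<eta>[OF x] vfunctor_sum_def module_sum_def interval_module_def)
    qed
    then show ?thesis
      using vF vG by (intro linear_map.intro mod_hom.intro mod_hom_axioms.intro vectorspace.axioms(1))
  qed
  have bijective: "bij_betw (\<eta> (e x)) (carrier (Ob F (e x))) (carrier (Ob ?G (e x)))" if x: "x \<le> h" for x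
  proof (rule bij_betwI')
    show "\<eta> (e x) u \<in> carrier (Ob ?G (e x))" if "u \<in> carrier (Ob F (e x))" for u
      by (rule \<eta>_closed[OF x that])
  next
    fix u v assume uv: "u \<in> carrier (Ob F (e x))" "v \<in> carrier (Ob F (e x))"
    let ?c = "\<lambda>m. \<kappa> m x (coord (e x) u)"
    have su: "coord (e x) u \<in> supported (e x)" "coord (e x) v \<in> supported (e x)"
      using uv coord_supported[OF e_P[OF x]] by auto
    have ex1: "\<exists>!w. w \<in> supported (e x) \<and> (\<forall>m<M. \<kappa> m x w = ?c m)"
      using bij[OF x] vanish[OF _ x su(1)] by simp
    show "(\<eta> (e x) u = \<eta> (e x) v) = (u = v)"
    proof
      assume "\<eta> (e x) u = \<eta> (e x) v"
      then have "\<kappa> m x (coord (e x) v) = ?c m" if "m < M" for m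
        using that unfolding \<eta>[OF x] by (metis lessThan_iff restrict_apply')
      then have "coord (e x) u = coord (e x) v" using ex1 su by blast
      then show "u = v" using uv comb_coord[OF e_P[OF x]] by metis
    qed simp
  next
    fix c assume c: "c \<in> carrier (Ob ?G (e x))"
    then obtain w where w: "w \<in> supported (e x)" "\<And>m. m < M \<Longrightarrow> \<kappa> m x w = c m"
      using bij[OF x, of c] unfolding carG[OF x] by auto
    have "\<eta> (e x) (comb (e x) w) = c"
      using c w unfolding \<eta>[OF x] carG[OF x] coord_comb[OF x w(1)]
      by (auto simp: extensional_def fun_eq_iff)
    then show "\<exists>u\<in>carrier (Ob F (e x)). c = \<eta> (e x) u"
      using comb_closed[OF e_P[OF x]] by blast
  qed
  have natural: "\<eta> (e y) (Mor F (e x) (e y) u) = Mor ?G (e x) (e y) (\<eta> (e x) u)"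
    if "x \<le> y" "y \<le> h" "u \<in> carrier (Ob F (e x))" for x y u
  proof -
    have x: "x \<le> h" using that(1,2) by (rule order_trans)
    have su: "coord (e x) u \<in> supported (e x)" by (rule coord_supported[OF e_P[OF x] that(3)])
    show ?thesis
      using nat[OF _ that(1,2) su] mem x that(2)
      by (auto simp: \<eta> T_coord[OF that(1-3), symmetric] vfunctor_sum_def interval_module_def fun_eq_iff)
  qed
  have Pe: "\<exists>x\<le>h. p = e x" if "p \<in> P" for p using e_bij that by (auto simp: bij_betw_def)
  have "vfunctor_iso P r F ?G"
    unfolding vfunctor_iso_def
  proof (intro exI[of _ \<eta>] conjI ballI allI impI)
    fix p assume "p \<in> P"
    then obtain x where "x \<le> h" "p = e x" using Pe by blast
    then show "linear_map (class_ring :: 'f ring) (Ob F p) (Ob ?G p) (\<eta> p)"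
      "bij_betw (\<eta> p) (carrier (Ob F p)) (carrier (Ob ?G p))"
      using linear bijective by auto
  next
    fix p q u assume pq: "(p, q) \<in> r" "u \<in> carrier (Ob F p)"
    then obtain x y where "x \<le> h" "y \<le> h" "p = e x" "q = e y" using r_P Pe by metis
    then show "\<eta> q (Mor F p q u) = Mor ?G p q (\<eta> p u)" using natural e_order pq by auto
  qed
  moreover have "poset_interval P r (e ` I m)" if "m < M" for m
    using boxes[OF that] box_interval by auto
  ultimately show ?thesis
    unfolding interval_decomposable_def by (intro exI[of _ "{..<M}"] exI[of _ "\<lambda>m. e ` I m"]) auto
qed

end

theorem corollary8p20:
  fixes N :: nat
    and S :: "nat \<Rightarrow> 'a set"
    and R :: "nat \<Rightarrow> 'a rel"
    and P :: "(nat \<Rightarrow> 'a) set"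
    and r :: "(nat \<Rightarrow> 'a) rel"
    and F :: "(nat \<Rightarrow> 'a, 'f::field, 'v) vfunctor"
  assumes "\<And>i. i < N \<Longrightarrow> finite (S i)"
    and "\<And>i. i < N \<Longrightarrow> linear_order_on (S i) (R i)"
    and "P = prod_carrier N S"
    and "r = prod_order N S R"
    and "is_vfunctor P r F"
    and "pointwise_fin_dim P F"
    and "\<And>k. 2 \<le> k \<Longrightarrow> k \<le> N \<Longrightarrow> middle_exact P r k F"
  shows "interval_decomposable P r F"
proof (cases "\<forall>i<N. S i \<noteq> {}")
  case True
  then obtain h e where "finite {i. 0 < h i}" "card {i. 0 < h i} \<le> N" "bij_betw e {x. x \<le> h} P"
    "\<forall>x\<le>h. \<forall>y\<le>h. (e x, e y) \<in> r \<longleftrightarrow> x \<le> (y :: nat \<Rightarrow> nat)"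
    using prod_coordinates[of N S R] assms(1-4) by metis
  moreover have "x \<in> P \<and> y \<in> P" if "(x, y) \<in> r" for x y
    using that unfolding assms(3,4) prod_order_def by blast
  ultimately interpret coordinatized P r F h e N
    using assms(5-7) by unfold_locales auto
  show ?thesis by (rule interval_decomposable)
next
  \<comment> \<open>An empty factor makes the poset empty, and the empty sum is a
    decomposition.\<close>
  case False
  then have P: "P = {}" unfolding assms(3) prod_carrier_def by (auto simp: PiE_eq_empty_iff)
  then have "r = {}" unfolding assms(3,4) prod_order_def by auto
  with P show ?thesis
    unfolding interval_decomposable_def vfunctor_iso_def by (intro exI[of _ "{}"]) auto
qed

end
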